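(* If $G$ is a discrete ICC group acting minimally on a unital C*-algebra $A$, then the reduced crossed product $A\rtimes_\lambda G$ is prime.
   Context: $G$ acts by *-automorphisms. $G$ is ICC if every $g\in G\setminus\{e\}$ has infinite conjugacy class. Ideals are closed and two-sided. The action is minimal if the only $G$-invariant ideals of $A$ are $0$ and $A$. A C*-algebra is prime if the product of any two non-zero ideals is non-zero. *)

theory Defs
  imports "HOL-Analysis.Analysis"
begin

section \<open>Complex normed spaces, algebras and Hilbert spaces\<close>

class complex_normed_vector = real_normed_vector +
  fixes scaleC :: "complex \<Rightarrow> 'a \<Rightarrow> 'a"  (infixr "*\<^sub>C" 75)
  assumes scaleC_add_right: "a *\<^sub>C (x + y) = a *\<^sub>C x + a *\<^sub>C y"
    and scaleC_add_left: "(a + b) *\<^sub>C x = a *\<^sub>C x + b *\<^sub>C x"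
    and scaleC_scaleC: "a *\<^sub>C b *\<^sub>C x = (a * b) *\<^sub>C x"
    and scaleC_of_real: "complex_of_real r *\<^sub>C x = r *\<^sub>R x"
    and norm_scaleC: "norm (a *\<^sub>C x) = cmod a * norm x"

lemma scaleC_one: "1 *\<^sub>C x = (x :: 'a :: complex_normed_vector)"
  using scaleC_of_real[of 1 x] by simp

global_interpretation complex_vector: vector_space
  "scaleC :: complex \<Rightarrow> 'a \<Rightarrow> 'a :: complex_normed_vector"
  defines csubspace_raw_def: csubspace = complex_vector.subspace
    and cspan_raw_def: cspan = complex_vector.span
  by unfold_locales (simp_all add: scaleC_add_right scaleC_add_left scaleC_scaleC scaleC_one)

class complex_normed_algebra = complex_normed_vector + real_normed_algebra +
  assumes mult_scaleC_left: "a *\<^sub>C x * y = a *\<^sub>C (x * y)"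
    and mult_scaleC_right: "x * a *\<^sub>C y = a *\<^sub>C (x * y)"

text \<open>The zero algebra is not excluded, which is why the unit comes from \<open>monoid_mult\<close> and not
  from \<open>ring_1\<close>.\<close>

class unital_cstar_algebra = complex_normed_algebra + banach + monoid_mult +
  fixes star :: "'a \<Rightarrow> 'a"
  assumes star_star: "star (star x) = x"
    and star_add: "star (x + y) = star x + star y"
    and star_scaleC: "star (a *\<^sub>C x) = cnj a *\<^sub>C star x"
    and star_mult: "star (x * y) = star y * star x"
    and cstar_identity: "norm (star x * x) = (norm x)\<^sup>2"

class complex_hilbert_space = complex_normed_vector + banach +
  fixes cinner :: "'a \<Rightarrow> 'a \<Rightarrow> complex"
  assumes cinner_commute: "cinner x y = cnj (cinner y x)"
    and cinner_add_left: "cinner (x + y) z = cinner x z + cinner y z"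
    and cinner_scaleC_left: "cinner (a *\<^sub>C x) y = a * cinner x y"
    and cinner_self: "cinner x x = complex_of_real ((norm x)\<^sup>2)"

lemma cinner_add_right: "cinner x (y + z) = cinner x y + cinner x (z :: 'h :: complex_hilbert_space)"
  by (metis cinner_add_left cinner_commute complex_cnj_add)

lemma cinner_scaleC_right: "cinner x (a *\<^sub>C y) = cnj a * cinner x (y :: 'h :: complex_hilbert_space)"
  by (metis cinner_scaleC_left cinner_commute complex_cnj_mult)

lemma norm_cinner_le: "cmod (cinner x y) \<le> norm x * norm (y :: 'h :: complex_hilbert_space)"
proof -
  obtain u where u: "cmod u = 1" "u * cinner x y = complex_of_real (cmod (cinner x y))"
  proof (cases "cinner x y = 0")
    case True
    then show ?thesis using that[of 1] by simp
  next
    case False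
    then have "cnj (cinner x y) / cmod (cinner x y) * cinner x y
        = complex_of_real (cmod (cinner x y))"
      by (simp add: field_simps complex_norm_square[symmetric] power2_eq_square)
    then show ?thesis using False that[of "cnj (cinner x y) / cmod (cinner x y)"]
      by (simp add: norm_divide)
  qed
  let ?x = "u *\<^sub>C x"
  have i: "cinner ?x y = complex_of_real (cmod (cinner x y))"
    by (simp add: cinner_scaleC_left u)
  have "complex_of_real ((norm (?x + y))\<^sup>2)
      = complex_of_real ((norm ?x)\<^sup>2 + 2 * cmod (cinner x y) + (norm y)\<^sup>2)"
    unfolding cinner_self[symmetric] cinner_add_left cinner_add_right i
    by (subst (2) cinner_commute) (simp add: i cinner_self)
  then have "(norm (?x + y))\<^sup>2 = (norm ?x)\<^sup>2 + 2 * cmod (cinner x y) + (norm y)\<^sup>2"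
    by (simp only: of_real_eq_iff)
  moreover have "(norm (?x + y))\<^sup>2 \<le> (norm ?x + norm y)\<^sup>2"
    by (simp add: norm_triangle_ineq power_mono)
  ultimately have "2 * cmod (cinner x y) \<le> 2 * (norm ?x * norm y)"
    by (simp add: power2_sum)
  then show ?thesis by (simp add: norm_scaleC u)
qed


section \<open>Bounded complex-linear operators\<close>

typedef (overloaded) 'h bounded_op =
  "{T :: 'h :: complex_normed_vector \<Rightarrow>\<^sub>L 'h. \<forall>a x. T (a *\<^sub>C x) = a *\<^sub>C T x}"
  by (rule exI[of _ 0]) simp

setup_lifting type_definition_bounded_op

lift_definition apply_op :: "'h :: complex_normed_vector bounded_op \<Rightarrow> 'h \<Rightarrow> 'h"
  is blinfun_apply .

lemma bounded_linear_scaleC_blinfun: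
  "bounded_linear (\<lambda>x. a *\<^sub>C blinfun_apply T (x :: 'h :: complex_normed_vector) :: 'h)"
proof (rule bounded_linear_intro[where K = "norm T * cmod a"])
  fix x y :: 'h and r :: real
  show "a *\<^sub>C T (x + y) = a *\<^sub>C T x + a *\<^sub>C T y"
    by (simp only: blinfun.add_right scaleC_add_right)
  show "a *\<^sub>C T (r *\<^sub>R x) = r *\<^sub>R a *\<^sub>C T x"
    unfolding blinfun.scaleR_right
    by (simp only: scaleC_of_real[symmetric] scaleC_scaleC mult.commute)
  show "norm (a *\<^sub>C T x) \<le> norm x * (norm T * cmod a)"
    using mult_left_mono[OF norm_blinfun[of T x], of "cmod a"]
    by (simp add: norm_scaleC mult_ac)
qed

instantiation bounded_op :: (complex_normed_vector) complex_normed_algebra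
begin
lift_definition zero_bounded_op :: "'a bounded_op" is 0 by simp
lift_definition plus_bounded_op :: "'a bounded_op \<Rightarrow> 'a bounded_op \<Rightarrow> 'a bounded_op" is "(+)"
  by (simp add: blinfun.add_left scaleC_add_right)
lift_definition minus_bounded_op :: "'a bounded_op \<Rightarrow> 'a bounded_op \<Rightarrow> 'a bounded_op" is "(-)"
  by (simp add: blinfun.diff_left complex_vector.scale_right_diff_distrib)
lift_definition uminus_bounded_op :: "'a bounded_op \<Rightarrow> 'a bounded_op" is uminus
  by (simp add: blinfun.minus_left)
lift_definition scaleR_bounded_op :: "real \<Rightarrow> 'a bounded_op \<Rightarrow> 'a bounded_op" is scaleR
  by (simp add: blinfun.scaleR_left scaleC_of_real[symmetric] scaleC_scaleC mult.commute)
lift_definition scaleC_bounded_op :: "complex \<Rightarrow> 'a bounded_op \<Rightarrow> 'a bounded_op"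
  is "\<lambda>a T. Blinfun (\<lambda>x. a *\<^sub>C blinfun_apply T x)"
  by (simp add: bounded_linear_Blinfun_apply[OF bounded_linear_scaleC_blinfun] mult.commute)
lift_definition times_bounded_op :: "'a bounded_op \<Rightarrow> 'a bounded_op \<Rightarrow> 'a bounded_op"
  is blinfun_compose by simp
lift_definition norm_bounded_op :: "'a bounded_op \<Rightarrow> real" is norm .
definition dist_bounded_op :: "'a bounded_op \<Rightarrow> 'a bounded_op \<Rightarrow> real"
  where "dist_bounded_op S T = norm (S - T)"
definition sgn_bounded_op :: "'a bounded_op \<Rightarrow> 'a bounded_op"
  where "sgn_bounded_op T = inverse (norm T) *\<^sub>R T"
definition uniformity_bounded_op :: "('a bounded_op \<times> 'a bounded_op) filter"
  where "uniformity_bounded_op = (INF e\<in>{0<..}. principal {(S, T). dist S T < e})"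
definition open_bounded_op :: "'a bounded_op set \<Rightarrow> bool"
  where "open_bounded_op U = (\<forall>T\<in>U. eventually (\<lambda>(S, S'). S = T \<longrightarrow> S' \<in> U) uniformity)"

lemma apply_scaleC_op: "apply_op (a *\<^sub>C T) x = a *\<^sub>C apply_op T x"
  by (simp add: apply_op.rep_eq scaleC_bounded_op.rep_eq
      bounded_linear_Blinfun_apply[OF bounded_linear_scaleC_blinfun])
lemma apply_add_op: "apply_op (S + T) x = apply_op S x + apply_op (T :: 'a bounded_op) x"
  by (simp add: apply_op.rep_eq plus_bounded_op.rep_eq blinfun.add_left)
lemma apply_diff_op: "apply_op (S - T) x = apply_op S x - apply_op (T :: 'a bounded_op) x"
  by (simp add: apply_op.rep_eq minus_bounded_op.rep_eq blinfun.diff_left)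
lemma apply_minus_op: "apply_op (- T) x = - apply_op (T :: 'a bounded_op) x"
  by (simp add: apply_op.rep_eq uminus_bounded_op.rep_eq blinfun.minus_left)
lemma apply_zero_op: "apply_op 0 x = (0 :: 'a)"
  by (simp add: apply_op.rep_eq zero_bounded_op.rep_eq)
lemma apply_scaleR_op: "apply_op (r *\<^sub>R T) x = r *\<^sub>R apply_op (T :: 'a bounded_op) x"
  by (simp add: apply_op.rep_eq scaleR_bounded_op.rep_eq blinfun.scaleR_left)
lemma apply_times_op: "apply_op (S * T) x = apply_op S (apply_op (T :: 'a bounded_op) x)"
  by (simp add: apply_op.rep_eq times_bounded_op.rep_eq)
lemma op_eqI: "(\<And>x. apply_op S x = apply_op T x) \<Longrightarrow> S = (T :: 'a bounded_op)"
  by (simp add: apply_op.rep_eq Rep_bounded_op_inject[symmetric] blinfun_eqI)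
lemma apply_op_scaleC: "apply_op T (a *\<^sub>C x) = a *\<^sub>C apply_op (T :: 'a bounded_op) x"
  using Rep_bounded_op[of T] by (simp add: apply_op.rep_eq)
lemma apply_op_add: "apply_op T (x + y) = apply_op T x + apply_op (T :: 'a bounded_op) y"
  by (simp add: apply_op.rep_eq blinfun.add_right)
lemma apply_op_scaleR: "apply_op T (r *\<^sub>R x) = r *\<^sub>R apply_op (T :: 'a bounded_op) x"
  by (simp add: apply_op.rep_eq blinfun.scaleR_right)
lemma norm_apply_op: "norm (apply_op T x) \<le> norm (T :: 'a bounded_op) * norm x"
  by (simp add: apply_op.rep_eq norm_bounded_op.rep_eq norm_blinfun)
lemma norm_times_op: "norm (S * T) \<le> norm S * norm (T :: 'a bounded_op)"
  by (simp add: times_bounded_op.rep_eq norm_bounded_op.rep_eq norm_blinfun_compose)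
lemma norm_op_bound: "0 \<le> B \<Longrightarrow> (\<And>x. norm (apply_op T x) \<le> B * norm x) \<Longrightarrow> norm (T :: 'a bounded_op) \<le> B"
  by (simp add: apply_op.rep_eq norm_bounded_op.rep_eq norm_blinfun_bound)

instance
proof
  fix S T U :: "'a bounded_op" and r s :: real and a b :: complex
  note op_simps = apply_add_op apply_diff_op apply_minus_op apply_zero_op apply_scaleR_op
    apply_times_op apply_scaleC_op apply_op_add apply_op_scaleR apply_op_scaleC
  show "S + T + U = S + (T + U)" "S + T = T + S" "0 + T = T" "- T + T = 0" "S - T = S + - T"
    "r *\<^sub>R (S + T) = r *\<^sub>R S + r *\<^sub>R T" "(r + s) *\<^sub>R S = r *\<^sub>R S + s *\<^sub>R S"
    "r *\<^sub>R s *\<^sub>R S = (r * s) *\<^sub>R S" "1 *\<^sub>R S = S"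
    "S * T * U = S * (T * U)" "(S + T) * U = S * U + T * U" "S * (T + U) = S * T + S * U"
    "r *\<^sub>R S * T = r *\<^sub>R (S * T)" "S * r *\<^sub>R T = r *\<^sub>R (S * T)"
    by (rule op_eqI, simp add: op_simps algebra_simps)+
  show "dist S T = norm (S - T)" by (simp add: dist_bounded_op_def)
  show "sgn S = inverse (norm S) *\<^sub>R S" by (simp add: sgn_bounded_op_def)
  show "(uniformity :: ('a bounded_op \<times> 'a bounded_op) filter)
      = (INF e\<in>{0<..}. principal {(S, T). dist S T < e})"
    by (rule uniformity_bounded_op_def)
  show "open V = (\<forall>T\<in>V. eventually (\<lambda>(S, S'). S = T \<longrightarrow> S' \<in> V) uniformity)"
    for V :: "'a bounded_op set" by (rule open_bounded_op_def)
  show "(norm S = 0) = (S = 0)" by (transfer, simp)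
  show "norm (S + T) \<le> norm S + norm T" by transfer (rule norm_triangle_ineq)
  show "norm (r *\<^sub>R S) = \<bar>r\<bar> * norm S" by (transfer, simp)
  show "a *\<^sub>C (S + T) = a *\<^sub>C S + a *\<^sub>C T" "(a + b) *\<^sub>C S = a *\<^sub>C S + b *\<^sub>C S"
    "a *\<^sub>C b *\<^sub>C S = (a * b) *\<^sub>C S" "complex_of_real r *\<^sub>C S = r *\<^sub>R S"
    "a *\<^sub>C S * T = a *\<^sub>C (S * T)" "S * a *\<^sub>C T = a *\<^sub>C (S * T)"
    by (rule op_eqI, simp add: op_simps scaleC_add_right scaleC_add_left scaleC_of_real)+
  show "norm (a *\<^sub>C S) = cmod a * norm S"
  proof (cases "a = 0")
    case True
    have "a *\<^sub>C S = 0"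
      by (rule op_eqI) (simp add: apply_scaleC_op apply_zero_op True)
    moreover have "norm (0 :: 'a bounded_op) = 0" by (transfer, simp)
    ultimately show ?thesis by (simp add: True)
  next
    case False
    have le: "norm (b *\<^sub>C U) \<le> cmod b * norm U" for b and U :: "'a bounded_op"
    proof (rule norm_op_bound)
      show "0 \<le> cmod b * norm U" by (transfer, simp)
      show "norm (apply_op (b *\<^sub>C U) x) \<le> cmod b * norm U * norm x" for x
        using mult_left_mono[OF norm_apply_op[of U x], of "cmod b"]
        by (simp add: apply_scaleC_op norm_scaleC mult.assoc)
    qed
    have "inverse a *\<^sub>C a *\<^sub>C S = S"
      by (rule op_eqI) (simp only: apply_scaleC_op scaleC_scaleC left_inverse[OF False] scaleC_one)
    then have "norm S \<le> inverse (cmod a) * norm (a *\<^sub>C S)"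
      using le[of "inverse a" "a *\<^sub>C S"] by (simp only: norm_inverse)
    from mult_left_mono[OF this, of "cmod a"] have "cmod a * norm S \<le> norm (a *\<^sub>C S)"
      by (simp only: mult.assoc[symmetric] right_inverse[of "cmod a"] norm_eq_zero False
          norm_ge_zero mult_1_left simp_thms)
    with le[of a S] show ?thesis by (rule order_antisym)
  qed
  show "norm (S * T) \<le> norm S * norm T" by (rule norm_times_op)
qed
end

instantiation bounded_op :: (complex_normed_vector) monoid_mult
begin
lift_definition one_bounded_op :: "'a bounded_op" is id_blinfun by simp
instance
proof
  fix T :: "'a bounded_op"
  show "1 * T = T" "T * 1 = T"
    by (transfer, rule blinfun_eqI, simp)+
qed
end

lemma apply_one_op: "apply_op 1 x = x"
  by (transfer, simp)


section \<open>The Hilbert space of square-summable functions\<close>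

typedef (overloaded) ('g, 'h) ell2 =
  "{\<xi> :: 'g \<Rightarrow> 'h :: complex_normed_vector. (\<lambda>g. (norm (\<xi> g))\<^sup>2) summable_on UNIV}"
  by (rule exI[of _ "\<lambda>_. 0"]) simp

setup_lifting type_definition_ell2

lift_definition ell2_apply :: "('g, 'h :: complex_normed_vector) ell2 \<Rightarrow> 'g \<Rightarrow> 'h" is "\<lambda>\<xi>. \<xi>" .

definition ell2_norm :: "('g \<Rightarrow> 'h :: real_normed_vector) \<Rightarrow> real"
  where "ell2_norm \<xi> = sqrt (\<Sum>\<^sub>\<infinity>g. (norm (\<xi> g))\<^sup>2)"

lemma ell2_boundI:
  fixes \<xi> :: "'g \<Rightarrow> 'h :: real_normed_vector"
  assumes "\<And>F. finite F \<Longrightarrow> L2_set (\<lambda>g. norm (\<xi> g)) F \<le> B"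
  shows "(\<lambda>g. (norm (\<xi> g))\<^sup>2) summable_on UNIV" and "ell2_norm \<xi> \<le> B"
proof -
  have "0 \<le> B" using assms[of "{}"] by simp
  have *: "(\<Sum>g\<in>F. (norm (\<xi> g))\<^sup>2) \<le> B\<^sup>2" if "finite F" for F
    using assms[OF that] \<open>0 \<le> B\<close> by (simp add: L2_set_def sqrt_le_D)
  show s: "(\<lambda>g. (norm (\<xi> g))\<^sup>2) summable_on UNIV"
    by (rule nonneg_bdd_above_summable_on) (auto intro!: bdd_aboveI[where M = "B\<^sup>2"] simp: *)
  have "(\<Sum>\<^sub>\<infinity>g. (norm (\<xi> g))\<^sup>2) \<le> B\<^sup>2"
    by (rule infsum_le_finite_sums[OF s]) (simp add: *)
  then show "ell2_norm \<xi> \<le> B"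
    using \<open>0 \<le> B\<close> by (simp add: ell2_norm_def real_le_lsqrt)
qed

lemma L2_set_le_ell2_norm:
  fixes \<xi> :: "'g \<Rightarrow> 'h :: real_normed_vector"
  assumes "(\<lambda>g. (norm (\<xi> g))\<^sup>2) summable_on UNIV" "finite F"
  shows "L2_set (\<lambda>g. norm (\<xi> g)) F \<le> ell2_norm \<xi>"
  unfolding L2_set_def ell2_norm_def
  by (intro real_sqrt_le_mono finite_sum_le_infsum) (use assms in auto)

lemma ell2_add_bound:
  fixes \<xi> \<eta> :: "'g \<Rightarrow> 'h :: real_normed_vector"
  assumes "(\<lambda>g. (norm (\<xi> g))\<^sup>2) summable_on UNIV" "(\<lambda>g. (norm (\<eta> g))\<^sup>2) summable_on UNIV" "finite F"
  shows "L2_set (\<lambda>g. norm (\<xi> g + \<eta> g)) F \<le> ell2_norm \<xi> + ell2_norm \<eta>"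
proof -
  have "L2_set (\<lambda>g. norm (\<xi> g + \<eta> g)) F \<le> L2_set (\<lambda>g. norm (\<xi> g) + norm (\<eta> g)) F"
    by (rule L2_set_mono) (auto intro: norm_triangle_ineq)
  also have "\<dots> \<le> L2_set (\<lambda>g. norm (\<xi> g)) F + L2_set (\<lambda>g. norm (\<eta> g)) F"
    by (rule L2_set_triangle_ineq)
  also have "\<dots> \<le> ell2_norm \<xi> + ell2_norm \<eta>"
    by (intro add_mono L2_set_le_ell2_norm assms)
  finally show ?thesis .
qed

lemma ell2_scale_bound:
  fixes \<xi> \<eta> :: "'g \<Rightarrow> 'h :: real_normed_vector"
  assumes "(\<lambda>g. (norm (\<xi> g))\<^sup>2) summable_on UNIV" "\<And>g. norm (\<eta> g) \<le> c * norm (\<xi> g)" "0 \<le> c" "finite F"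
  shows "L2_set (\<lambda>g. norm (\<eta> g)) F \<le> c * ell2_norm \<xi>"
proof -
  have "L2_set (\<lambda>g. norm (\<eta> g)) F \<le> L2_set (\<lambda>g. c * norm (\<xi> g)) F"
    by (rule L2_set_mono) (auto intro: assms)
  also have "\<dots> = c * L2_set (\<lambda>g. norm (\<xi> g)) F"
    using assms by (simp add: L2_set_right_distrib)
  also have "\<dots> \<le> c * ell2_norm \<xi>"
    by (intro mult_left_mono L2_set_le_ell2_norm assms)
  finally show ?thesis .
qed

instantiation ell2 :: (type, complex_normed_vector) complex_normed_vector
begin
lift_definition zero_ell2 :: "('a, 'b) ell2" is "\<lambda>_. 0" by simp
lift_definition plus_ell2 :: "('a, 'b) ell2 \<Rightarrow> ('a, 'b) ell2 \<Rightarrow> ('a, 'b) ell2" is "\<lambda>\<xi> \<eta> g. \<xi> g + \<eta> g"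
  by (rule ell2_boundI(1), rule ell2_add_bound)
lift_definition uminus_ell2 :: "('a, 'b) ell2 \<Rightarrow> ('a, 'b) ell2" is "\<lambda>\<xi> g. - \<xi> g"
  by simp
lift_definition minus_ell2 :: "('a, 'b) ell2 \<Rightarrow> ('a, 'b) ell2 \<Rightarrow> ('a, 'b) ell2" is "\<lambda>\<xi> \<eta> g. \<xi> g - \<eta> g"
proof -
  fix \<xi> \<eta> :: "'a \<Rightarrow> 'b"
  assume "(\<lambda>g. (norm (\<xi> g))\<^sup>2) summable_on UNIV" "(\<lambda>g. (norm (\<eta> g))\<^sup>2) summable_on UNIV"
  then show "(\<lambda>g. (norm (\<xi> g - \<eta> g))\<^sup>2) summable_on UNIV"
    using ell2_boundI(1)[OF ell2_add_bound[of \<xi> "\<lambda>g. - \<eta> g"]] by simp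
qed
lift_definition scaleR_ell2 :: "real \<Rightarrow> ('a, 'b) ell2 \<Rightarrow> ('a, 'b) ell2" is "\<lambda>r \<xi> g. r *\<^sub>R \<xi> g"
  by (rule ell2_boundI(1), rule ell2_scale_bound) auto
lift_definition scaleC_ell2 :: "complex \<Rightarrow> ('a, 'b) ell2 \<Rightarrow> ('a, 'b) ell2" is "\<lambda>a \<xi> g. a *\<^sub>C \<xi> g"
  by (rule ell2_boundI(1), rule ell2_scale_bound) (auto simp: norm_scaleC)
lift_definition norm_ell2 :: "('a, 'b) ell2 \<Rightarrow> real" is ell2_norm .
definition dist_ell2 :: "('a, 'b) ell2 \<Rightarrow> ('a, 'b) ell2 \<Rightarrow> real"
  where "dist_ell2 \<xi> \<eta> = norm (\<xi> - \<eta>)"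
definition sgn_ell2 :: "('a, 'b) ell2 \<Rightarrow> ('a, 'b) ell2"
  where "sgn_ell2 \<xi> = inverse (norm \<xi>) *\<^sub>R \<xi>"
definition uniformity_ell2 :: "(('a, 'b) ell2 \<times> ('a, 'b) ell2) filter"
  where "uniformity_ell2 = (INF e\<in>{0<..}. principal {(\<xi>, \<eta>). dist \<xi> \<eta> < e})"
definition open_ell2 :: "('a, 'b) ell2 set \<Rightarrow> bool"
  where "open_ell2 U = (\<forall>\<xi>\<in>U. eventually (\<lambda>(\<eta>, \<zeta>). \<eta> = \<xi> \<longrightarrow> \<zeta> \<in> U) uniformity)"

lemma ell2_eqI: "(\<And>g. ell2_apply \<xi> g = ell2_apply \<eta> g) \<Longrightarrow> \<xi> = (\<eta> :: ('a, 'b) ell2)"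
  by transfer auto

lemma ell2_apply_simps [simp]:
  "ell2_apply (0 :: ('a, 'b) ell2) g = 0"
  "ell2_apply (\<xi> + (\<eta> :: ('a, 'b) ell2)) g = ell2_apply \<xi> g + ell2_apply \<eta> g"
  "ell2_apply (\<xi> - (\<eta> :: ('a, 'b) ell2)) g = ell2_apply \<xi> g - ell2_apply \<eta> g"
  "ell2_apply (- (\<xi> :: ('a, 'b) ell2)) g = - ell2_apply \<xi> g"
  "ell2_apply (r *\<^sub>R (\<xi> :: ('a, 'b) ell2)) g = r *\<^sub>R ell2_apply \<xi> g"
  "ell2_apply (a *\<^sub>C (\<xi> :: ('a, 'b) ell2)) g = a *\<^sub>C ell2_apply \<xi> g"
  by (transfer, simp)+

lemma norm_scaleC_ell2: "norm (a *\<^sub>C \<xi>) = cmod a * norm (\<xi> :: ('a, 'b) ell2)"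
proof (transfer fixing: a)
  fix \<xi> :: "'a \<Rightarrow> 'b" assume "(\<lambda>g. (norm (\<xi> g))\<^sup>2) summable_on UNIV"
  then show "ell2_norm (\<lambda>g. a *\<^sub>C \<xi> g) = cmod a * ell2_norm \<xi>"
    by (simp add: ell2_norm_def norm_scaleC power_mult_distrib infsum_cmult_right real_sqrt_mult)
qed

instance
proof
  fix \<xi> \<eta> \<zeta> :: "('a, 'b) ell2" and r s :: real and a b :: complex
  show "\<xi> + \<eta> + \<zeta> = \<xi> + (\<eta> + \<zeta>)" "\<xi> + \<eta> = \<eta> + \<xi>" "0 + \<xi> = \<xi>" "- \<xi> + \<xi> = 0" "\<xi> - \<eta> = \<xi> + - \<eta>"
    "r *\<^sub>R (\<xi> + \<eta>) = r *\<^sub>R \<xi> + r *\<^sub>R \<eta>" "(r + s) *\<^sub>R \<xi> = r *\<^sub>R \<xi> + s *\<^sub>R \<xi>"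
    "r *\<^sub>R s *\<^sub>R \<xi> = (r * s) *\<^sub>R \<xi>" "1 *\<^sub>R \<xi> = \<xi>"
    by (rule ell2_eqI, simp add: algebra_simps)+
  show cR: "complex_of_real r *\<^sub>C \<xi> = r *\<^sub>R \<xi>" for r and \<xi> :: "('a, 'b) ell2"
    by (rule ell2_eqI) (simp add: scaleC_of_real)
  show "a *\<^sub>C (\<xi> + \<eta>) = a *\<^sub>C \<xi> + a *\<^sub>C \<eta>" "(a + b) *\<^sub>C \<xi> = a *\<^sub>C \<xi> + b *\<^sub>C \<xi>"
    "a *\<^sub>C b *\<^sub>C \<xi> = (a * b) *\<^sub>C \<xi>"
    by (rule ell2_eqI, simp add: scaleC_add_right scaleC_add_left)+
  show "dist \<xi> \<eta> = norm (\<xi> - \<eta>)" by (simp add: dist_ell2_def)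
  show "sgn \<xi> = inverse (norm \<xi>) *\<^sub>R \<xi>" by (simp add: sgn_ell2_def)
  show "(uniformity :: (('a, 'b) ell2 \<times> ('a, 'b) ell2) filter)
      = (INF e\<in>{0<..}. principal {(\<xi>, \<eta>). dist \<xi> \<eta> < e})"
    by (rule uniformity_ell2_def)
  show "open U = (\<forall>\<xi>\<in>U. eventually (\<lambda>(\<eta>, \<zeta>). \<eta> = \<xi> \<longrightarrow> \<zeta> \<in> U) uniformity)"
    for U :: "('a, 'b) ell2 set" by (rule open_ell2_def)
  show "(norm \<xi> = 0) = (\<xi> = 0)"
  proof transfer
    fix \<xi> :: "'a \<Rightarrow> 'b" assume s: "(\<lambda>g. (norm (\<xi> g))\<^sup>2) summable_on UNIV"
    show "(ell2_norm \<xi> = 0) = (\<xi> = (\<lambda>_. 0))"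
    proof
      assume "ell2_norm \<xi> = 0"
      then have "norm (\<xi> g) \<le> 0" for g
        using L2_set_le_ell2_norm[OF s, of "{g}"] by simp
      then show "\<xi> = (\<lambda>_. 0)" by auto
    qed (simp add: ell2_norm_def)
  qed
  show "norm (\<xi> + \<eta>) \<le> norm \<xi> + norm \<eta>"
    by transfer (rule ell2_boundI(2), rule ell2_add_bound)
  show n: "norm (a *\<^sub>C \<xi>) = cmod a * norm \<xi>" for a by (rule norm_scaleC_ell2)
  show "norm (r *\<^sub>R \<xi>) = \<bar>r\<bar> * norm \<xi>"
    using n[of "complex_of_real r"] by (simp add: cR)
qed
end

lemma norm_ell2_apply_le: "norm (ell2_apply \<xi> g) \<le> norm (\<xi> :: ('a, 'b :: complex_normed_vector) ell2)"
proof transfer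
  fix \<xi> :: "'a \<Rightarrow> 'b" and g assume "(\<lambda>g. (norm (\<xi> g))\<^sup>2) summable_on UNIV"
  from L2_set_le_ell2_norm[OF this, of "{g}"] show "norm (\<xi> g) \<le> ell2_norm \<xi>" by simp
qed

lemma L2_set_le_norm_ell2: "finite F \<Longrightarrow> L2_set (\<lambda>g. norm (ell2_apply \<xi> g)) F \<le> norm \<xi>"
  by transfer (rule L2_set_le_ell2_norm)

instantiation ell2 :: (type, complex_hilbert_space) complex_hilbert_space
begin
lift_definition cinner_ell2 :: "('a, 'b) ell2 \<Rightarrow> ('a, 'b) ell2 \<Rightarrow> complex"
  is "\<lambda>\<xi> \<eta>. \<Sum>\<^sub>\<infinity>g. cinner (\<xi> g) (\<eta> g)" .
instance
proof
  fix X :: "nat \<Rightarrow> ('a, 'b) ell2"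
  assume X: "Cauchy X"
  have "Cauchy (\<lambda>n. ell2_apply (X n) g)" for g
  proof (rule CauchyI)
    fix e :: real assume "0 < e"
    then obtain N where N: "\<And>m n. m \<ge> N \<Longrightarrow> n \<ge> N \<Longrightarrow> norm (X m - X n) < e"
      using CauchyD[OF X] by metis
    have "norm (ell2_apply (X m) g - ell2_apply (X n) g) < e" if "m \<ge> N" "n \<ge> N" for m n
      using norm_ell2_apply_le[of "X m - X n" g] N[OF that] by simp
    then show "\<exists>N. \<forall>m\<ge>N. \<forall>n\<ge>N. norm (ell2_apply (X m) g - ell2_apply (X n) g) < e" by blast
  qed
  then have "\<And>g. convergent (\<lambda>n. ell2_apply (X n) g)"
    by (rule Cauchy_convergent)
  then have f: "(\<lambda>n. ell2_apply (X n) g) \<longlonglongrightarrow> lim (\<lambda>n. ell2_apply (X n) g)" for g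
    unfolding convergent_LIMSEQ_iff .
  define f where "f g = lim (\<lambda>n. ell2_apply (X n) g)" for g
  note f = f[folded f_def]
  have tail: "\<exists>N. \<forall>n\<ge>N. \<forall>F. finite F \<longrightarrow> L2_set (\<lambda>g. norm (ell2_apply (X n) g - f g)) F \<le> e"
    if "0 < e" for e
  proof -
    obtain N where N: "\<And>m n. m \<ge> N \<Longrightarrow> n \<ge> N \<Longrightarrow> norm (X m - X n) < e"
      using CauchyD[OF X \<open>0 < e\<close>] by metis
    have "L2_set (\<lambda>g. norm (ell2_apply (X n) g - f g)) F \<le> e" if "n \<ge> N" "finite F" for n F
    proof (rule LIMSEQ_le_const2)
      show "(\<lambda>m. L2_set (\<lambda>g. norm (ell2_apply (X n) g - ell2_apply (X m) g)) F)
          \<longlonglongrightarrow> L2_set (\<lambda>g. norm (ell2_apply (X n) g - f g)) F"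
        unfolding L2_set_def by (intro tendsto_intros f)
      show "\<exists>M. \<forall>m\<ge>M. L2_set (\<lambda>g. norm (ell2_apply (X n) g - ell2_apply (X m) g)) F \<le> e"
      proof (intro exI[of _ N] allI impI)
        fix m assume "m \<ge> N"
        then show "L2_set (\<lambda>g. norm (ell2_apply (X n) g - ell2_apply (X m) g)) F \<le> e"
          using L2_set_le_norm_ell2[OF \<open>finite F\<close>, of "X n - X m"] N[OF \<open>n \<ge> N\<close>, of m] by simp
      qed
    qed
    then show ?thesis by blast
  qed
  obtain N where "\<And>F. finite F \<Longrightarrow> L2_set (\<lambda>g. norm (ell2_apply (X N) g - f g)) F \<le> 1"
    using tail[of 1] by auto
  then have "(\<lambda>g. (norm (ell2_apply (X N) g - f g))\<^sup>2) summable_on UNIV"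
    by (rule ell2_boundI(1))
  then have \<zeta>: "ell2_apply (Abs_ell2 (\<lambda>g. ell2_apply (X N) g - f g)) g = ell2_apply (X N) g - f g" for g
    by (simp add: Abs_ell2_inverse ell2_apply.rep_eq)
  define L where "L = X N - Abs_ell2 (\<lambda>g. ell2_apply (X N) g - f g)"
  have L: "ell2_apply L g = f g" for g by (simp add: L_def \<zeta>)
  have le: "norm \<xi> \<le> B" if "\<And>F. finite F \<Longrightarrow> L2_set (\<lambda>g. norm (ell2_apply \<xi> g)) F \<le> B"
    for \<xi> :: "('a, 'b) ell2" and B
    using that by transfer (rule ell2_boundI(2))
  have "X \<longlonglongrightarrow> L"
  proof (rule LIMSEQ_I)
    fix e :: real assume "0 < e"
    then obtain N where
      N: "\<And>n F. n \<ge> N \<Longrightarrow> finite F \<Longrightarrow> L2_set (\<lambda>g. norm (ell2_apply (X n) g - f g)) F \<le> e / 2"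
      using tail[of "e / 2"] by auto
    have "norm (X n - L) < e" if "n \<ge> N" for n
      using le[of "X n - L" "e / 2"] N[OF that] \<open>0 < e\<close> by (simp add: L)
    then show "\<exists>N. \<forall>n\<ge>N. norm (X n - L) < e" by blast
  qed
  then show "convergent X" by (rule convergentI)
next
  have sm: "(\<lambda>g. cinner (\<xi> g) (\<eta> g)) summable_on UNIV"
    if s: "(\<lambda>g. (norm (\<xi> g))\<^sup>2) summable_on UNIV" "(\<lambda>g. (norm (\<eta> g))\<^sup>2) summable_on UNIV"
    for \<xi> \<eta> :: "'a \<Rightarrow> 'b"
  proof -
    have s': "(\<lambda>g. (norm (\<xi> g))\<^sup>2 + (norm (\<eta> g))\<^sup>2) summable_on UNIV"
      by (intro summable_on_add s)
    have "cmod (cinner (\<xi> g) (\<eta> g)) \<le> (norm (\<xi> g))\<^sup>2 + (norm (\<eta> g))\<^sup>2" for g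
      using norm_cinner_le[of "\<xi> g" "\<eta> g"] sum_squares_bound[of "norm (\<xi> g)" "norm (\<eta> g)"]
        mult_nonneg_nonneg[OF norm_ge_zero[of "\<xi> g"] norm_ge_zero[of "\<eta> g"]] by linarith
    then have "(\<lambda>g. norm (cinner (\<xi> g) (\<eta> g))) summable_on UNIV"
      by (rule summable_on_comparison_test[OF s']) (rule norm_ge_zero)
    then show ?thesis by (rule abs_summable_summable)
  qed
  fix \<xi> \<eta> \<zeta> :: "('a, 'b) ell2" and a :: complex
  show "cinner \<xi> \<eta> = cnj (cinner \<eta> \<xi>)"
    unfolding cinner_ell2.rep_eq infsum_cnj[symmetric] by (subst cinner_commute) (rule refl)
  show "cinner (\<xi> + \<eta>) \<zeta> = cinner \<xi> \<zeta> + cinner \<eta> \<zeta>"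
    by transfer (simp add: cinner_add_left infsum_add sm)
  show "cinner (a *\<^sub>C \<xi>) \<eta> = a * cinner \<xi> \<eta>"
    by transfer (simp add: cinner_scaleC_left infsum_cmult_right sm)
  show "cinner \<xi> \<xi> = complex_of_real ((norm \<xi>)\<^sup>2)"
  proof transfer
    fix \<xi> :: "'a \<Rightarrow> 'b" assume "(\<lambda>g. (norm (\<xi> g))\<^sup>2) summable_on UNIV"
    then have "(\<Sum>\<^sub>\<infinity>g. cinner (\<xi> g) (\<xi> g)) = complex_of_real (\<Sum>\<^sub>\<infinity>g. (norm (\<xi> g))\<^sup>2)"
      unfolding cinner_self
      by (intro infsumI has_sum_of_real has_sum_infsum)
    moreover have "0 \<le> (\<Sum>\<^sub>\<infinity>g. (norm (\<xi> g))\<^sup>2)" by (simp add: infsum_nonneg)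
    ultimately show "(\<Sum>\<^sub>\<infinity>g. cinner (\<xi> g) (\<xi> g)) = complex_of_real ((ell2_norm \<xi>)\<^sup>2)"
      by (simp add: ell2_norm_def)
  qed
qed
end

section \<open>C*-algebraic preliminaries\<close>

lemma star_one: "star 1 = (1 :: 'a :: unital_cstar_algebra)"
  by (metis mult_1_left mult_1_right star_mult star_star)

lemma norm_one_le: "norm (1 :: 'a :: unital_cstar_algebra) \<le> 1"
  using cstar_identity[of "1 :: 'a"] by (auto simp: star_one power2_eq_square)

lemma norm_star: "norm (star x) = norm (x :: 'a :: unital_cstar_algebra)"
proof -
  have *: "norm y \<le> norm (star y)" for y :: 'a
  proof (cases "norm y = 0")
    case False
    have "norm y * norm y \<le> norm (star y) * norm y"
      using norm_mult_ineq[of "star y" y] by (simp add: cstar_identity power2_eq_square)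
    then show ?thesis using False by (simp add: mult_le_cancel_right)
  qed simp
  from *[of x] *[of "star x"] show ?thesis by (simp add: star_star)
qed

lemma star_scaleR: "star (r *\<^sub>R x) = r *\<^sub>R star (x :: 'a :: unital_cstar_algebra)"
  using star_scaleC[of "complex_of_real r" x] by (simp add: scaleC_of_real)

lemma bounded_linear_star: "bounded_linear (star :: 'a \<Rightarrow> 'a :: unital_cstar_algebra)"
  by (rule bounded_linear_intro[where K = 1]) (simp_all add: star_add star_scaleR norm_star)

lemma star_power: "star (x ^ n) = star x ^ n" for x :: "'a :: unital_cstar_algebra"
  by (induction n) (simp_all add: star_one star_mult power_commutes)

lemma norm_power_le: "norm (x ^ n) \<le> norm x ^ n" for x :: "'a :: unital_cstar_algebra"
proof (induction n)
  case (Suc n)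
  have "norm (x ^ Suc n) \<le> norm x * norm (x ^ n)"
    by (simp add: norm_mult_ineq)
  also have "\<dots> \<le> norm x * norm x ^ n"
    by (intro mult_left_mono Suc.IH norm_ge_zero)
  finally show ?case by simp
qed (simp add: norm_one_le)

lemma selfadjoint_sqrt_exists:
  fixes x :: "'a :: unital_cstar_algebra"
  assumes "star x = x" "norm x < 1"
  obtains b where "star b = b" "b * b = 1 - x"
proof -
  define c where "c n = (-1) ^ n * ((1 / 2 :: real) gchoose n)" for n
  define f where "f n = c n *\<^sub>R x ^ n" for n
  have "(1 / 2 :: real) \<notin> \<nat>"
  proof
    assume "(1 / 2 :: real) \<in> \<nat>"
    then obtain n where "(1 / 2 :: real) = real n" by (auto simp: Nats_def)
    then have "real (2 * n) = real 1" by simp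
    then have "2 * n = 1" by (simp only: of_nat_eq_iff)
    then show False by presburger
  qed
  then have "conv_radius (\<lambda>n. (1 / 2 :: real) gchoose n) = 1"
    by (simp add: conv_radius_gchoose)
  then have s: "summable (\<lambda>n. norm (((1 / 2 :: real) gchoose n) * norm x ^ n))"
    by (intro abs_summable_in_conv_radius) (use assms in simp)
  have f: "summable (\<lambda>n. norm (f n))"
  proof (rule summable_comparison_test'[OF s])
    show "norm (norm (f n)) \<le> norm (((1 / 2 :: real) gchoose n) * norm x ^ n)" for n
      using mult_left_mono[OF norm_power_le[of x n], of "\<bar>c n\<bar>"]
      by (simp add: f_def c_def abs_mult power_abs)
  qed
  define b where "b = (\<Sum>n. f n)"
  have conv: "(\<Sum>i\<le>k. f i * f (k - i)) = ((-1) ^ k * ((1 :: real) gchoose k)) *\<^sub>R x ^ k" for k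
  proof -
    have "f i * f (k - i) = ((-1) ^ k * (((1 / 2 :: real) gchoose i) * ((1 / 2) gchoose (k - i)))) *\<^sub>R x ^ k"
      if "i \<le> k" for i
    proof -
      have "x ^ i * x ^ (k - i) = x ^ k" "(-1) ^ i * (-1) ^ (k - i) = ((-1) ^ k :: real)"
        using that by (simp_all only: power_add[symmetric] le_add_diff_inverse)
      then show ?thesis
        unfolding f_def c_def by (simp only: mult_scaleR_left mult_scaleR_right scaleR_scaleR mult_ac)
          (metis mult.assoc)
    qed
    then have "(\<Sum>i\<le>k. f i * f (k - i))
        = ((-1) ^ k * (\<Sum>i\<le>k. ((1 / 2 :: real) gchoose i) * ((1 / 2) gchoose (k - i)))) *\<^sub>R x ^ k"
      by (simp add: scaleR_sum_left[symmetric] sum_distrib_left)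
    then show ?thesis
      using gbinomial_Vandermonde[of "1 / 2 :: real" "1 / 2" k] by (simp add: atMost_atLeast0)
  qed
  have "(\<lambda>k. ((-1) ^ k * ((1 :: real) gchoose k)) *\<^sub>R x ^ k) sums (b * b)"
    using Cauchy_product_sums[OF f f] by (simp add: b_def conv)
  moreover have "(\<lambda>k. ((-1) ^ k * ((1 :: real) gchoose k)) *\<^sub>R x ^ k) sums
      (\<Sum>k\<in>{0, 1}. ((-1) ^ k * ((1 :: real) gchoose k)) *\<^sub>R x ^ k)"
  proof (rule sums_finite)
    fix k :: nat assume "k \<notin> {0, 1}"
    then have "(1 :: real) gchoose k = 0"
      using binomial_gbinomial[of 1 k, where 'a = real] by (simp add: binomial_eq_0)
    then show "((-1) ^ k * ((1 :: real) gchoose k)) *\<^sub>R x ^ k = 0" by simp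
  qed simp
  ultimately have "b * b = 1 - x" using sums_unique2 by fastforce
  moreover have "star b = b"
    unfolding b_def bounded_linear.suminf[OF bounded_linear_star summable_norm_cancel[OF f]]
    by (rule suminf_cong) (simp add: f_def star_scaleR star_power assms)
  ultimately show ?thesis using that by blast
qed

definition star_representation ::
    "('a :: unital_cstar_algebra \<Rightarrow> 'h :: complex_hilbert_space bounded_op) \<Rightarrow> bool"
  where "star_representation \<rho> \<longleftrightarrow>
    (\<forall>a b. \<rho> (a + b) = \<rho> a + \<rho> b) \<and> (\<forall>z a. \<rho> (z *\<^sub>C a) = z *\<^sub>C \<rho> a) \<and>
    (\<forall>a b. \<rho> (a * b) = \<rho> a * \<rho> b) \<and> \<rho> 1 = 1 \<and>
    (\<forall>a x y. cinner (apply_op (\<rho> (star a)) x) y = cinner x (apply_op (\<rho> a) y))"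

definition faithful_representation ::
    "('a :: unital_cstar_algebra \<Rightarrow> 'h :: complex_hilbert_space bounded_op) \<Rightarrow> bool"
  where "faithful_representation \<rho> \<longleftrightarrow> star_representation \<rho> \<and> inj \<rho>"

lemma star_representation_contractive:
  fixes \<rho> :: "'a :: unital_cstar_algebra \<Rightarrow> 'h :: complex_hilbert_space bounded_op"
  assumes \<rho>: "star_representation \<rho>"
  shows "norm (\<rho> a) \<le> norm a"
proof -
  have add: "\<rho> (a + b) = \<rho> a + \<rho> b" and scale: "\<rho> (z *\<^sub>C a) = z *\<^sub>C \<rho> a" and mult: "\<rho> (a * b) = \<rho> a * \<rho> b"
    and one: "\<rho> 1 = 1"
    and adj: "cinner (apply_op (\<rho> (star a)) x) y = cinner x (apply_op (\<rho> a) y)" for a b z x y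
    using \<rho> by (auto simp: star_representation_def)
  have unit: "norm (apply_op (\<rho> a) v) \<le> norm v" if "norm a < 1" for a v
  proof -
    let ?y = "star a * a"
    have "norm ?y < 1" using that by (simp add: cstar_identity power_less_one_iff)
    then obtain b where b: "star b = b" "b * b = 1 - ?y"
      using selfadjoint_sqrt_exists[of ?y] by (auto simp: star_mult star_star)
    have "1 = b * b + ?y" by (simp add: b)
    then have "\<rho> 1 = \<rho> b * \<rho> b + \<rho> (star a) * \<rho> a" by (metis add mult)
    then have "v = apply_op (\<rho> b) (apply_op (\<rho> b) v) + apply_op (\<rho> (star a)) (apply_op (\<rho> a) v)"
      by (metis one apply_one_op apply_add_op apply_times_op)
    then have "cinner v v = cinner (apply_op (\<rho> b) v) (apply_op (\<rho> b) v)
        + cinner (apply_op (\<rho> a) v) (apply_op (\<rho> a) v)"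
      using adj[of b "apply_op (\<rho> b) v" v] adj[of a "apply_op (\<rho> a) v" v]
      by (metis b(1) cinner_add_left)
    then have "complex_of_real ((norm v)\<^sup>2)
        = complex_of_real ((norm (apply_op (\<rho> b) v))\<^sup>2 + (norm (apply_op (\<rho> a) v))\<^sup>2)"
      by (simp add: cinner_self)
    then have "(norm v)\<^sup>2 = (norm (apply_op (\<rho> b) v))\<^sup>2 + (norm (apply_op (\<rho> a) v))\<^sup>2"
      by (simp only: of_real_eq_iff)
    then have "(norm (apply_op (\<rho> a) v))\<^sup>2 \<le> (norm v)\<^sup>2" by simp
    then show ?thesis by (rule power2_le_imp_le) simp
  qed
  show ?thesis
  proof (rule dense_ge)
    fix r assume r: "norm a < r"
    then have "0 < r" using norm_ge_zero[of a] by linarith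
    let ?a = "complex_of_real (inverse r) *\<^sub>C a"
    have "norm ?a = inverse r * norm a"
      using \<open>0 < r\<close> by (simp only: norm_scaleC norm_of_real) simp
    also have "\<dots> < 1" using r \<open>0 < r\<close> by (simp add: field_simps)
    finally have "norm ?a < 1" .
    then have "norm (\<rho> ?a) \<le> 1" using unit[of ?a] by (intro norm_op_bound) auto
    then have "inverse r * norm (\<rho> a) \<le> 1"
      using \<open>0 < r\<close> by (simp only: scale norm_scaleC norm_of_real) simp
    then show "norm (\<rho> a) \<le> r" using \<open>0 < r\<close> by (simp add: field_simps)
  qed
qed


section \<open>Group actions and reduced crossed products\<close>

text \<open>The class \<open>group_add\<close> is that of arbitrary groups, written additively; it does not impose
  commutativity. The conjugate of \<open>g\<close> by \<open>h\<close> is \<open>h + g - h\<close>.\<close>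

definition icc_group :: "'g :: group_add itself \<Rightarrow> bool"
  where "icc_group _ \<longleftrightarrow> (\<forall>g :: 'g. g \<noteq> 0 \<longrightarrow> infinite (range (\<lambda>h. h + g - h)))"

definition star_automorphism :: "('a :: unital_cstar_algebra \<Rightarrow> 'a) \<Rightarrow> bool"
  where "star_automorphism f \<longleftrightarrow> bij f \<and>
    (\<forall>a b. f (a + b) = f a + f b) \<and> (\<forall>z a. f (z *\<^sub>C a) = z *\<^sub>C f a) \<and>
    (\<forall>a b. f (a * b) = f a * f b) \<and> (\<forall>a. f (star a) = star (f a))"

definition cstar_action :: "('g :: group_add \<Rightarrow> 'a :: unital_cstar_algebra \<Rightarrow> 'a) \<Rightarrow> bool"
  where "cstar_action \<alpha> \<longleftrightarrow> (\<forall>g. star_automorphism (\<alpha> g)) \<and>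
    (\<forall>a. \<alpha> 0 a = a) \<and> (\<forall>g h a. \<alpha> (g + h) a = \<alpha> g (\<alpha> h a))"

text \<open>Ideals of the closed subalgebra with underlying set \<open>M\<close>; the whole algebra is \<open>UNIV\<close>.\<close>

definition closed_ideal :: "'a :: complex_normed_algebra set \<Rightarrow> 'a set \<Rightarrow> bool"
  where "closed_ideal M I \<longleftrightarrow> I \<subseteq> M \<and> csubspace I \<and> closed I \<and>
    (\<forall>m\<in>M. \<forall>x\<in>I. m * x \<in> I \<and> x * m \<in> I)"

definition ideal_product :: "'a :: complex_normed_algebra set \<Rightarrow> 'a set \<Rightarrow> 'a set"
  where "ideal_product I J = closure (cspan {x * y | x y. x \<in> I \<and> y \<in> J})"

definition prime_cstar_algebra :: "'a :: complex_normed_algebra set \<Rightarrow> bool"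
  where "prime_cstar_algebra M \<longleftrightarrow>
    (\<forall>I J. closed_ideal M I \<and> closed_ideal M J \<and> I \<noteq> {0} \<and> J \<noteq> {0} \<longrightarrow> ideal_product I J \<noteq> {0})"

definition minimal_action :: "('g :: group_add \<Rightarrow> 'a :: unital_cstar_algebra \<Rightarrow> 'a) \<Rightarrow> bool"
  where "minimal_action \<alpha> \<longleftrightarrow>
    (\<forall>I. closed_ideal UNIV I \<and> (\<forall>g. \<alpha> g ` I \<subseteq> I) \<longrightarrow> I = {0} \<or> I = UNIV)"

lift_definition ell2_shift :: "'g :: group_add \<Rightarrow> ('g, 'h :: complex_normed_vector) ell2 \<Rightarrow> ('g, 'h) ell2"
  is "\<lambda>g \<xi> h. \<xi> (- g + h)"
proof -
  fix g :: 'g and \<xi> :: "'g \<Rightarrow> 'h" assume "(\<lambda>h. (norm (\<xi> h))\<^sup>2) summable_on UNIV"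
  then show "(\<lambda>h. (norm (\<xi> (- g + h)))\<^sup>2) summable_on UNIV"
    using summable_on_reindex_bij_betw[OF bij_plus[of "- g"], of "\<lambda>h. (norm (\<xi> h))\<^sup>2"] by simp
qed

lemma ell2_apply_shift: "ell2_apply (ell2_shift g \<xi>) h = ell2_apply \<xi> (- g + h)"
  by (simp add: ell2_apply.rep_eq ell2_shift.rep_eq)

lemma norm_ell2_shift: "norm (ell2_shift g \<xi>) = norm \<xi>"
  using infsum_reindex_bij_betw[OF bij_plus[of "- g"], of "\<lambda>h. (norm (Rep_ell2 \<xi> h))\<^sup>2"]
  by (simp add: norm_ell2.rep_eq ell2_norm_def ell2_shift.rep_eq)

definition operator_of :: "('h :: complex_normed_vector \<Rightarrow> 'h) \<Rightarrow> 'h bounded_op"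
  where "operator_of f = Abs_bounded_op (Blinfun f)"

lemma apply_operator_of:
  assumes "\<And>x y. f (x + y) = f x + f y" "\<And>a x. f (a *\<^sub>C x) = a *\<^sub>C f x"
    "\<And>x. norm (f x) \<le> B * norm x"
  shows "apply_op (operator_of f) x = f x"
proof -
  have "bounded_linear f"
  proof (rule bounded_linear_intro[where K = B])
    show "f (r *\<^sub>R x) = r *\<^sub>R f x" for r x
      using assms(2)[of "complex_of_real r" x] by (simp only: scaleC_of_real)
  qed (use assms in \<open>auto simp: mult.commute\<close>)
  then show ?thesis
    by (simp add: operator_of_def apply_op.rep_eq Abs_bounded_op_inverse bounded_linear_Blinfun_apply assms)
qed

definition translation_op :: "'g :: group_add \<Rightarrow> ('g, 'h :: complex_hilbert_space) ell2 bounded_op"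
  where "translation_op g = operator_of (ell2_shift g)"

lemma apply_translation_op: "ell2_apply (apply_op (translation_op g) \<xi>) h = ell2_apply \<xi> (- g + h)"
proof -
  have "apply_op (translation_op g) \<xi> = ell2_shift g \<xi>"
    unfolding translation_op_def
    by (rule apply_operator_of[where B = 1])
      (auto intro!: ell2_eqI simp: ell2_apply_shift norm_ell2_shift)
  then show ?thesis by (simp add: ell2_apply_shift)
qed

text \<open>\<open>diagonal_op T\<close> is the direct sum of the operators \<open>T g\<close>, which is meaningful only if they are
  uniformly bounded.\<close>

definition diagonal_op :: "('g \<Rightarrow> 'h :: complex_hilbert_space bounded_op) \<Rightarrow> ('g, 'h) ell2 bounded_op"
  where "diagonal_op T = operator_of (\<lambda>\<xi>. Abs_ell2 (\<lambda>g. apply_op (T g) (ell2_apply \<xi> g)))"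

lemma apply_diagonal_op:
  fixes T :: "'g \<Rightarrow> 'h :: complex_hilbert_space bounded_op"
  assumes T: "\<And>g. norm (T g) \<le> B"
  shows "ell2_apply (apply_op (diagonal_op T) \<xi>) g = apply_op (T g) (ell2_apply \<xi> g)"
proof -
  let ?f = "\<lambda>\<xi>. Abs_ell2 (\<lambda>g. apply_op (T g) (ell2_apply \<xi> g))"
  have "0 \<le> B" using order_trans[OF norm_ge_zero T] .
  have le: "L2_set (\<lambda>g. norm (apply_op (T g) (ell2_apply \<xi> g))) F \<le> B * norm \<xi>" if "finite F" for \<xi> F
    unfolding norm_ell2.rep_eq
  proof (rule ell2_scale_bound[OF _ _ \<open>0 \<le> B\<close> that])
    show "(\<lambda>g. (norm (Rep_ell2 \<xi> g))\<^sup>2) summable_on UNIV" using Rep_ell2[of \<xi>] by simp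
    show "norm (apply_op (T g) (ell2_apply \<xi> g)) \<le> B * norm (Rep_ell2 \<xi> g)" for g
      using order_trans[OF norm_apply_op mult_right_mono[OF T norm_ge_zero]]
      by (simp add: ell2_apply.rep_eq)
  qed
  have ap: "ell2_apply (?f \<xi>) g = apply_op (T g) (ell2_apply \<xi> g)" for \<xi> g
    using ell2_boundI(1)[OF le] by (simp add: ell2_apply.rep_eq Abs_ell2_inverse)
  have "apply_op (diagonal_op T) \<xi> = ?f \<xi>"
    unfolding diagonal_op_def
  proof (rule apply_operator_of[where B = B])
    show "norm (?f \<xi>) \<le> B * norm \<xi>" for \<xi>
      using ell2_boundI[OF le, of \<xi>] by (simp add: norm_ell2.rep_eq Abs_ell2_inverse)
      show "?f (\<xi> + \<eta>) = ?f \<xi> + ?f \<eta>" for \<xi> \<eta>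
      by (rule ell2_eqI) (use ap[of "\<xi> + \<eta>"] ap[of \<xi>] ap[of \<eta>] in \<open>simp add: apply_op_add\<close>)
    show "?f (z *\<^sub>C \<xi>) = z *\<^sub>C ?f \<xi>" for z \<xi>
      by (rule ell2_eqI) (use ap[of "z *\<^sub>C \<xi>"] ap[of \<xi>] in \<open>simp add: apply_op_scaleC\<close>)
  qed
  then show ?thesis by (simp add: ap)
qed

text \<open>The regular representation on \<open>\<ell>\<^sup>2(G, H)\<close> induced by a representation \<open>\<rho>\<close> of \<open>A\<close> on \<open>H\<close>:
  \<open>(regular_rep \<rho> \<alpha> a \<xi>)(h) = \<rho> (\<alpha>\<^bsub>h\<^esub>\<^sup>-\<^sup>1 a) \<xi>(h)\<close>. Together with the translation operators it is a
  covariant representation.\<close>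

definition regular_rep :: "('a :: unital_cstar_algebra \<Rightarrow> 'h :: complex_hilbert_space bounded_op) \<Rightarrow>
    ('g :: group_add \<Rightarrow> 'a \<Rightarrow> 'a) \<Rightarrow> 'a \<Rightarrow> ('g, 'h) ell2 bounded_op"
  where "regular_rep \<rho> \<alpha> a = diagonal_op (\<lambda>h. \<rho> (\<alpha> (- h) a))"

lemma apply_regular_rep:
  assumes \<rho>: "star_representation \<rho>" and \<alpha>: "cstar_action \<alpha>"
  shows "ell2_apply (apply_op (regular_rep \<rho> \<alpha> a) \<xi>) h = apply_op (\<rho> (\<alpha> (- h) a)) (ell2_apply \<xi> h)"
  unfolding regular_rep_def
proof (rule apply_diagonal_op)
  fix h
  have aut: "star_automorphism (\<alpha> (- h))" using \<alpha> by (simp add: cstar_action_def)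
  then obtain u where u: "\<alpha> (- h) u = 1" by (metis star_automorphism_def bij_pointE)
  have "\<alpha> (- h) 1 = 1" using aut u by (metis star_automorphism_def mult_1_left mult_1_right)
  then have "star_representation (\<lambda>a. \<rho> (\<alpha> (- h) a))"
    using \<rho> aut by (simp add: star_representation_def star_automorphism_def)
  then show "norm (\<rho> (\<alpha> (- h) a)) \<le> norm a"
    by (rule star_representation_contractive)
qed

text \<open>For faithful \<open>\<rho>\<close> the resulting C*-algebra does not depend on \<open>\<rho>\<close> up to isomorphism.\<close>

definition reduced_crossed_product ::
    "('a :: unital_cstar_algebra \<Rightarrow> 'h :: complex_hilbert_space bounded_op) \<Rightarrow>
     ('g :: group_add \<Rightarrow> 'a \<Rightarrow> 'a) \<Rightarrow> ('g, 'h) ell2 bounded_op set"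
  where "reduced_crossed_product \<rho> \<alpha> =
    closure (cspan {regular_rep \<rho> \<alpha> a * translation_op g | a g. True})"

end

theory Submission
  imports Defs
begin

text \<open>
  A faithful representation is isometric: a self-adjoint \<open>h\<close> with \<open>\<parallel>\<rho> h\<parallel> < s < \<parallel>h\<parallel>\<close> would make
  \<open>|h\<^sup>2 - s\<^sup>2| + (h\<^sup>2 - s\<^sup>2)\<close> a non-zero element of the kernel. Write \<open>E\<close> for the canonical conditional
  expectation. For a non-zero ideal \<open>I\<close> of the crossed product, \<open>E(I)\<close> is a non-zero invariant
  ideal of \<open>A\<close>, hence by minimality dense. Given two non-zero ideals \<open>I\<close> and \<open>J\<close> with zero product,
  pick \<open>x \<in> I\<close> and \<open>y \<in> J\<close> with \<open>E(x)\<close> and \<open>E(y)\<close> close to \<open>1\<close>, and finitely supported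
  approximations \<open>x'\<close> and \<open>y'\<close>. As \<open>G\<close> is ICC, some \<open>g\<close> conjugates the support of \<open>y'\<close> off the
  inverse of that of \<open>x'\<close> (except at the identity), so that
  \<open>E(x' u\<^sub>g y' u\<^sub>g\<^sup>*) = E(x') E(u\<^sub>g y' u\<^sub>g\<^sup>*)\<close>. The right-hand side is close to \<open>1\<close>, while the left-hand
  side is close to \<open>E(x u\<^sub>g y u\<^sub>g\<^sup>*) = 0\<close>.
\<close>

section \<open>Disjoint conjugates in ICC groups\<close>

text \<open>Induction on \<open>E\<close> for all \<open>F\<close> at once: a \<open>g\<close> that
  works for the old elements is corrected at the new one by a further conjugation from a finite
  list, and \<open>F\<close> is enlarged beforehand so that the correction does no harm. This
  elementary argument replaces B. H. Neumann's lemma on coverings by cosets of centralizers.\<close>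

lemma ex_conjugate_disjoint:
  fixes F E :: "'g :: group_add set"
  assumes icc: "icc_group TYPE('g)" and "finite E" "finite F" "0 \<notin> E"
  shows "\<exists>g. \<forall>r\<in>E. g + r - g \<notin> F"
  using assms(2-4)
proof (induction E arbitrary: F rule: finite_induct)
  case empty
  then show ?case by simp
next
  case (insert r E)
  have "\<exists>k. k + d - k \<notin> F" if "d \<noteq> 0" for d
  proof -
    have "infinite (range (\<lambda>k. k + d - k))"
      using icc that by (simp add: icc_group_def)
    then have "\<not> range (\<lambda>k. k + d - k) \<subseteq> F"
      using insert.prems(1) finite_subset by blast
    then show ?thesis by blast
  qed
  then obtain k where k: "\<And>d. d \<noteq> 0 \<Longrightarrow> k d + d - k d \<notin> F"
    by metis
  \<comment> \<open>If \<open>g\<close> moves \<open>E\<close> off \<open>F'\<close> but \<open>d = g + r - g\<close> still lies in \<open>F\<close>, then \<open>k d + g\<close> works.\<close>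
  define F' where "F' = F \<union> (\<Union>d\<in>F. (\<lambda>f. - k d + f + k d) ` F)"
  have "finite F'"
    using insert.prems(1) by (simp add: F'_def)
  then obtain g where g: "\<And>e. e \<in> E \<Longrightarrow> g + e - g \<notin> F'"
    using insert.IH[of F'] insert.prems(2) by auto
  show ?case
  proof (cases "g + r - g \<in> F")
    case False
    then show ?thesis
      using g by (intro exI[of _ g]) (auto simp: F'_def)
  next
    case True
    define d where "d = g + r - g"
    have "d \<noteq> 0"
    proof
      assume "d = 0"
      then have "r = - g + 0 + g"
        unfolding d_def by (metis add.assoc add_0_right diff_add_cancel left_minus minus_add_cancel)
      then show False using insert.prems(2) by simp
    qed
    have conj: "k d + g + e - (k d + g) = k d + (g + e - g) - k d" for e
      by (simp add: diff_conv_add_uminus minus_add add.assoc del: add_uminus_conv_diff)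
    have "k d + (g + e - g) - k d \<notin> F" if "e \<in> E" for e
    proof
      assume *: "k d + (g + e - g) - k d \<in> F"
      have "g + e - g = - k d + (k d + (g + e - g) - k d) + k d"
        by (simp add: diff_conv_add_uminus add.assoc del: add_uminus_conv_diff)
      then have "g + e - g \<in> F'"
        using * True unfolding F'_def d_def by blast
      then show False using g[OF that] by simp
    qed
    moreover have "k d + (g + r - g) - k d \<notin> F"
      using k[OF \<open>d \<noteq> 0\<close>] unfolding d_def .
    ultimately show ?thesis
      by (intro exI[of _ "k d + g"]) (auto simp: conj)
  qed
qed

section \<open>Faithful representations are isometric\<close>

text \<open>The \<open>c n\<close> are the Taylor coefficients of sqrt (1 - t). All but
  \<open>c 0 = 1\<close> are non-positive, and the partial sums at t = 1 stay non-negative, so the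
  absolute values after \<open>c 0\<close> cannot add up to more than 1.\<close>

lemma alternating_half_binomial:
  defines "c \<equiv> \<lambda>n. (-1) ^ n * ((1 / 2 :: real) gchoose n)"
  shows "summable (\<lambda>n. \<bar>c n\<bar>)" and "(\<Sum>n. \<bar>c (Suc n)\<bar>) \<le> 1"
proof -
  \<comment> \<open>Rising factorials make the signs visible: for \<open>a = 1 / 2\<close> the first
    factor is negative and the others are positive.\<close>
  have poch: "(-1) ^ n * (a gchoose n) = pochhammer (- a) n / fact n" for a :: real and n
    by (simp add: gbinomial_pochhammer mult.assoc[symmetric] power_mult_distrib[symmetric])
  have "c (Suc n) \<le> 0" for n
    using pochhammer_pos[of "1 / 2 :: real" n]
    by (simp add: c_def poch pochhammer_rec divide_nonpos_pos del: power_Suc)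
  moreover have "(\<Sum>k\<le>m. c k) \<ge> 0" for m
    using gbinomial_sum_lower_neg[of "1 / 2 :: real" m] poch[of m "- 1 / 2"]
      pochhammer_pos[of "1 / 2 :: real" m]
    by (simp add: c_def mult.commute)
  then have "0 \<le> c 0 + (\<Sum>k<n. c (Suc k))" for n
    using sum.atMost_shift[of c n] by metis
  moreover have "c 0 = 1" by (simp add: c_def)
  ultimately have le: "(\<Sum>k<n. \<bar>c (Suc k)\<bar>) \<le> 1" for n
    by (simp add: abs_of_nonpos sum_negf) (metis add.commute neg_le_iff_le minus_le_iff le_minus_iff diff_le_eq diff_0)
  have "summable (\<lambda>n. \<bar>c (Suc n)\<bar>)"
    by (rule bounded_imp_summable[where B = 1]) (use le[of "Suc _"] in \<open>auto simp: lessThan_Suc_atMost simp del: sum.lessThan_Suc\<close>)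
  then show "summable (\<lambda>n. \<bar>c n\<bar>)"
    by (subst (asm) summable_Suc_iff)
  show "(\<Sum>n. \<bar>c (Suc n)\<bar>) \<le> 1"
    by (rule suminf_le_const) (use \<open>summable (\<lambda>n. \<bar>c (Suc n)\<bar>)\<close> le in auto)
qed

text \<open>In contrast to \<open>selfadjoint_sqrt_exists\<close>, this covers the boundary \<open>norm x = 1\<close>, where \<open>0\<close> may be in the
  spectrum of \<open>1 - x\<close>.\<close>

lemma ex_commuting_sqrt:
  fixes x :: "'a :: unital_cstar_algebra"
  assumes x: "star x = x" "norm x \<le> 1"
  obtains b where "star b = b" "b * b = 1 - x" "norm (1 - b) \<le> 1"
    "\<And>z. z * x = x * z \<Longrightarrow> z * b = b * z"
proof -
  define c where "c n = (-1) ^ n * ((1 / 2 :: real) gchoose n)" for n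
  define f where "f n = c n *\<^sub>R x ^ n" for n
  have c: "summable (\<lambda>n. \<bar>c n\<bar>)" "(\<Sum>n. \<bar>c (Suc n)\<bar>) \<le> 1"
    using alternating_half_binomial by (simp_all add: c_def[abs_def])
  have nf: "norm (f n) \<le> \<bar>c n\<bar>" for n
    using mult_left_mono[of "norm (x ^ n)" 1 "\<bar>c n\<bar>"] norm_power_le[of x n] power_le_one[of "norm x" n] x
    by (simp add: f_def)
  have f: "summable (\<lambda>n. norm (f n))"
    by (rule summable_comparison_test'[OF c(1)]) (simp add: nf)
  define b where "b = (\<Sum>n. f n)"
  \<comment> \<open>By Vandermonde's identity the Cauchy square has the coefficients of (1 - t)^1,
    which vanish beyond degree 1.\<close>
  have conv: "(\<Sum>i\<le>k. f i * f (k - i)) = ((-1) ^ k * ((1 :: real) gchoose k)) *\<^sub>R x ^ k" for k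
  proof -
    have "f i * f (k - i) = ((-1) ^ k * ((1 / 2 gchoose i) * (1 / 2 gchoose (k - i)))) *\<^sub>R x ^ k"
      if "i \<le> k" for i
    proof -
      have "x ^ i * x ^ (k - i) = x ^ k" "(-1) ^ i * (-1) ^ (k - i) = ((-1) ^ k :: real)"
        using that by (simp_all only: power_add[symmetric] le_add_diff_inverse)
      then show ?thesis
        by (simp add: f_def c_def mult.commute)
    qed
    then show ?thesis
      using gbinomial_Vandermonde[of "1 / 2 :: real" "1 / 2" k]
      by (simp add: scaleR_sum_left[symmetric] sum_distrib_left[symmetric] atMost_atLeast0)
  qed
  have gc: "(1 :: real) gchoose k = 0" if "k \<notin> {0, 1}" for k
    using that binomial_gbinomial[of 1 k, where 'a = real] by (simp add: binomial_eq_0)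
  have "(\<lambda>k. ((-1) ^ k * ((1 :: real) gchoose k)) *\<^sub>R x ^ k) sums
      (\<Sum>k\<in>{0, 1}. ((-1) ^ k * ((1 :: real) gchoose k)) *\<^sub>R x ^ k)"
    by (rule sums_finite) (simp_all add: gc)
  moreover have "(\<lambda>k. ((-1) ^ k * ((1 :: real) gchoose k)) *\<^sub>R x ^ k) sums (b * b)"
    using Cauchy_product_sums[OF f f] by (simp add: b_def conv)
  ultimately have "b * b = 1 - x" using sums_unique2 by fastforce
  moreover have "star b = b"
    unfolding b_def bounded_linear.suminf[OF bounded_linear_star summable_norm_cancel[OF f]]
    by (rule suminf_cong) (simp add: f_def star_scaleR star_power x)
  \<comment> \<open>This bound stands in for positivity of \<open>b\<close>: it permits a second
    root, of \<open>b = 1 - (1 - b)\<close>. It holds because the constant term of the series is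
    1.\<close>
  moreover have "norm (1 - b) \<le> 1"
  proof -
    have "1 - b = - (\<Sum>n. f (Suc n))"
      using suminf_split_head[OF summable_norm_cancel[OF f]] by (simp add: b_def f_def c_def)
    then have "norm (1 - b) = norm (\<Sum>n. f (Suc n))" by simp
    also have "\<dots> \<le> (\<Sum>n. \<bar>c (Suc n)\<bar>)"
      by (rule norm_suminf_le) (use summable_ignore_initial_segment[OF c(1), of 1] nf in auto)
    finally show ?thesis using c(2) by simp
  qed
  moreover have "z * b = b * z" if "z * x = x * z" for z
  proof -
    have "z * x ^ n = x ^ n * z" for n
      by (induction n) (use that in \<open>simp_all, metis mult.assoc\<close>)
    then have "z * f n = f n * z" for n by (simp add: f_def)
    then show ?thesis
      using suminf_mult[OF summable_norm_cancel[OF f], of z] suminf_mult2[OF summable_norm_cancel[OF f], of z]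
      by (simp add: b_def)
  qed
  ultimately show ?thesis using that by blast
qed

lemma star_diff: "star (x - y) = star x - star (y :: 'a :: unital_cstar_algebra)"
  using bounded_linear.linear[OF bounded_linear_star] by (rule linear_diff)

text \<open>\<open>h + \<i> e\<close> is \<open>s\<close> times a unitary.\<close>

lemma norm_le_if_sum_squares:
  fixes h e :: "'a :: unital_cstar_algebra"
  assumes "star h = h" "star e = e" "h * e = e * h" and eq: "h * h + e * e = s\<^sup>2 *\<^sub>R 1" and "0 \<le> s"
  shows "norm h \<le> s"
proof -
  define u where "u = h + \<i> *\<^sub>C e"
  have su: "star u = h - \<i> *\<^sub>C e"
    by (simp add: u_def star_add star_scaleC assms)
  have "star u * u = h * h + e * e"
    unfolding su unfolding u_def
    by (simp add: algebra_simps mult_scaleC_left mult_scaleC_right scaleC_scaleC scaleC_one assms(3)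
        complex_vector.scale_minus_left)
  then have "(norm u)\<^sup>2 = s\<^sup>2 * norm (1 :: 'a)"
    by (simp add: cstar_identity[symmetric] eq)
  also have "\<dots> \<le> s\<^sup>2 * 1"
    by (intro mult_left_mono norm_one_le) simp
  finally have u: "norm u \<le> s"
    using power2_le_imp_le \<open>0 \<le> s\<close> by simp
  \<comment> \<open>\<open>h\<close> is the real part of \<open>u\<close>.\<close>
  have "2 *\<^sub>R h = u + star u" unfolding su by (simp add: u_def scaleR_2)
  then have "2 * norm h = norm (u + star u)" by (metis norm_scaleR abs_numeral)
  also have "\<dots> \<le> s + s"
    using norm_triangle_ineq[of u "star u"] u by (simp add: norm_star)
  finally show ?thesis by simp
qed

text \<open>A root \<open>b\<close> of \<open>1 - c * c\<close> that commutes with \<open>c\<close>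
  satisfies \<open>b * b + c * c = 1\<close>, so \<open>b\<close> has norm at most 1, and so has its
  square. This takes the place of functional calculus.\<close>

lemma norm_one_minus_square_le:
  fixes c :: "'a :: unital_cstar_algebra"
  assumes c: "star c = c" "norm c \<le> 1"
  shows "norm (1 - c * c) \<le> 1"
proof -
  have "norm (c * c) \<le> 1"
    using cstar_identity[of c] c by (simp add: power_le_one)
  moreover have "star (c * c) = c * c" by (simp add: star_mult c)
  ultimately obtain b where b: "star b = b" "b * b = 1 - c * c"
      "\<And>z. z * (c * c) = c * c * z \<Longrightarrow> z * b = b * z"
    using ex_commuting_sqrt by blast
  have "b * c = c * b"
    by (rule b(3)[symmetric]) (rule mult.assoc[symmetric])
  then have "norm b \<le> 1"
    using norm_le_if_sum_squares[of b c 1] b(1,2) c by simp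
  then have "(norm b)\<^sup>2 \<le> 1" by (simp add: power_le_one)
  then show ?thesis
    using cstar_identity[of b] b(1,2) by simp
qed

section \<open>Lower norm bounds for faithful representations\<close>

lemma cinner_self_adjoint_square:
  fixes \<rho> :: "'a :: unital_cstar_algebra \<Rightarrow> 'h :: complex_hilbert_space bounded_op"
  assumes \<rho>: "star_representation \<rho>" and "star e = e"
  shows "cinner (apply_op (\<rho> (e * e)) v) v = complex_of_real ((norm (apply_op (\<rho> e) v))\<^sup>2)"
proof -
  have "\<rho> (e * e) = \<rho> e * \<rho> e"
    and "cinner (apply_op (\<rho> (star e)) x) v = cinner x (apply_op (\<rho> e) v)" for x
    using \<rho> by (simp_all add: star_representation_def)
  then show ?thesis by (simp add: apply_times_op cinner_self \<open>star e = e\<close>)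
qed

text \<open>With \<open>c = h * h - s\<^sup>2\<close>, the element |c| + c is killed by
  \<open>\<rho>\<close>. Injectivity gives |c| = - c, so \<open>h * h\<close> and |c| add up to
  \<open>s\<^sup>2\<close>, which forces \<open>norm h \<le> s\<close>. The bound 1 / 2 is a
  normalization that gives \<open>c\<close> norm at most 1, as the series for the roots
  requires.\<close>

lemma faithful_representation_lower_bound_self_adjoint:
  fixes \<rho> :: "'a :: unital_cstar_algebra \<Rightarrow> 'h :: complex_hilbert_space bounded_op"
  assumes \<rho>: "faithful_representation \<rho>" and h: "star h = h" "norm h \<le> 1 / 2"
  shows "norm h \<le> norm (\<rho> h)"
proof (rule ccontr)
  have rep: "star_representation \<rho>" and "inj \<rho>"
    using \<rho> by (auto simp: faithful_representation_def)
  have add: "\<rho> (a + b) = \<rho> a + \<rho> b" and scale: "\<rho> (z *\<^sub>C a) = z *\<^sub>C \<rho> a"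
    and mult: "\<rho> (a * b) = \<rho> a * \<rho> b" and one: "\<rho> 1 = 1" for a b z
    using rep by (auto simp: star_representation_def)
  have zero: "\<rho> 0 = 0" using add[of 0 0] by simp
  have diff: "\<rho> (a - b) = \<rho> a - \<rho> b" for a b
    using add[of "a - b" b] by simp
  have scaleR: "\<rho> (r *\<^sub>R a) = r *\<^sub>R \<rho> a" for r a
    using scale[of "complex_of_real r" a] by (simp add: scaleC_of_real)
  assume "\<not> norm h \<le> norm (\<rho> h)"
  then obtain s where s: "norm (\<rho> h) < s" "s < norm h"
    using dense[of "norm (\<rho> h)" "norm h"] by auto
  have "0 < s" using s(1) norm_ge_zero[of "\<rho> h"] by linarith
  define c where "c = h * h - s\<^sup>2 *\<^sub>R 1"
  have sc: "star c = c"
    by (simp add: c_def star_diff star_mult star_scaleR star_one h)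
  have "(norm h)\<^sup>2 \<le> (1 / 2)\<^sup>2" "s\<^sup>2 \<le> (1 / 2)\<^sup>2"
    using s h \<open>0 < s\<close> by (auto intro!: power_mono)
  moreover have "norm c \<le> (norm h)\<^sup>2 + s\<^sup>2 * norm (1 :: 'a)"
    using norm_triangle_ineq4[of "h * h" "s\<^sup>2 *\<^sub>R 1"] cstar_identity[of h] h by (simp add: c_def)
  moreover have "s\<^sup>2 * norm (1 :: 'a) \<le> s\<^sup>2"
    using mult_left_mono[OF norm_one_le, of "s\<^sup>2"] by simp
  ultimately have "norm c \<le> 1" by (simp add: power2_eq_square)
  then have "norm (1 - c * c) \<le> 1" by (rule norm_one_minus_square_le[OF sc])
  moreover have "star (1 - c * c) = 1 - c * c"
    by (simp add: star_diff star_mult star_one sc)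
  \<comment> \<open>Two roots are taken in turn: \<open>d * d = c * c\<close>, then
    \<open>e * e = d\<close>. Through \<open>e\<close>, the positivity of \<open>d\<close> can be
    used after applying \<open>\<rho>\<close>.\<close>
  ultimately obtain d where d: "star d = d" "d * d = 1 - (1 - c * c)" "norm (1 - d) \<le> 1"
      "\<And>z. z * (1 - c * c) = (1 - c * c) * z \<Longrightarrow> z * d = d * z"
    using ex_commuting_sqrt by blast
  have "star (1 - d) = 1 - d"
    by (simp add: star_diff star_one d)
  then obtain e where e: "star e = e" "e * e = 1 - (1 - d)" "\<And>z. z * (1 - d) = (1 - d) * z \<Longrightarrow> z * e = e * z"
    using ex_commuting_sqrt d(3) by blast
  have hc: "h * c = c * h" by (simp add: c_def algebra_simps)
  have "z * d = d * z" if "z * c = c * z" for z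
  proof -
    have "z * (c * c) = c * c * z" using that by (metis mult.assoc)
    then show ?thesis by (intro d(4)) (simp add: algebra_simps)
  qed
  then have dc: "c * d = d * c" and dh: "h * d = d * h" using hc by auto
  have eh: "h * e = e * h"
    by (rule e(3)) (simp add: algebra_simps dh)
  \<comment> \<open>\<open>d = |c|\<close>, and \<open>\<rho> (d - c)\<close> is bounded below because \<open>- \<rho> c\<close> is at least \<open>s\<^sup>2 - \<parallel>\<rho> h\<parallel>\<^sup>2\<close>.\<close>
  have prod: "(d - c) * (d + c) = 0" by (simp add: algebra_simps d dc)
  have "apply_op (\<rho> (d + c)) v = 0" for v
  proof -
    define w where "w = apply_op (\<rho> (d + c)) v"
    have "apply_op (\<rho> (d - c)) w = 0"
      unfolding w_def apply_times_op[symmetric] mult[symmetric] prod zero apply_zero_op ..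
    \<comment> \<open>Pairing with \<open>w\<close> gives \<open>s\<^sup>2 * (norm w)\<^sup>2 \<le>
      (norm (\<rho> h) * norm w)\<^sup>2\<close>, and \<open>norm (\<rho> h) < s\<close> leaves only
      \<open>w = 0\<close>.\<close>
    moreover have "d - c = e * e + s\<^sup>2 *\<^sub>R 1 - h * h" by (simp add: c_def e)
    ultimately have "apply_op (\<rho> (e * e)) w + s\<^sup>2 *\<^sub>R w = apply_op (\<rho> (h * h)) w"
      by (simp add: diff add scaleR one apply_diff_op apply_add_op apply_scaleR_op apply_one_op)
    then have "cinner (apply_op (\<rho> (e * e)) w) w + complex_of_real (s\<^sup>2) * cinner w w
        = cinner (apply_op (\<rho> (h * h)) w) w"
      unfolding scaleC_of_real[symmetric] by (metis cinner_add_left cinner_scaleC_left)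
    then have "complex_of_real ((norm (apply_op (\<rho> e) w))\<^sup>2 + s\<^sup>2 * (norm w)\<^sup>2)
        = complex_of_real ((norm (apply_op (\<rho> h) w))\<^sup>2)"
      by (simp only: cinner_self_adjoint_square[OF rep] e(1) h(1) cinner_self of_real_add of_real_mult)
    then have "(norm (apply_op (\<rho> e) w))\<^sup>2 + s\<^sup>2 * (norm w)\<^sup>2 = (norm (apply_op (\<rho> h) w))\<^sup>2"
      by (simp only: of_real_eq_iff)
    then have "s\<^sup>2 * (norm w)\<^sup>2 \<le> (norm (apply_op (\<rho> h) w))\<^sup>2"
      using zero_le_power2[of "norm (apply_op (\<rho> e) w)"] by linarith
    also have "\<dots> \<le> (norm (\<rho> h) * norm w)\<^sup>2"
      by (intro power_mono norm_apply_op norm_ge_zero)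
    finally have "s\<^sup>2 * (norm w)\<^sup>2 \<le> (norm (\<rho> h))\<^sup>2 * (norm w)\<^sup>2" by (simp add: power_mult_distrib)
    moreover have "(norm (\<rho> h))\<^sup>2 < s\<^sup>2" using s by (intro power_strict_mono) auto
    ultimately show ?thesis unfolding w_def[symmetric]
      by (metis mult_le_cancel_right norm_eq_zero not_less zero_less_power2)
  qed
  then have "\<rho> (d + c) = \<rho> 0" by (intro op_eqI) (simp add: zero apply_zero_op)
  then have "d + c = 0" using \<open>inj \<rho>\<close> by (simp only: inj_eq)
  then have "h * h + e * e = s\<^sup>2 *\<^sub>R 1" by (simp add: c_def e algebra_simps)
  then have "norm h \<le> s"
    using norm_le_if_sum_squares[OF h(1) e(1) eh] \<open>0 < s\<close> by simp
  then show False using s by simp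
qed

text \<open>The C*-identity in \<open>A\<close> reduces the claim to a rescaled
  \<open>star a * a\<close>; the extra factor \<open>\<rho> (star a)\<close> is bounded by
  contractivity.\<close>

lemma faithful_representation_isometric:
  fixes \<rho> :: "'a :: unital_cstar_algebra \<Rightarrow> 'h :: complex_hilbert_space bounded_op"
  assumes \<rho>: "faithful_representation \<rho>"
  shows "norm (\<rho> a) = norm a"
proof (rule order_antisym)
  have rep: "star_representation \<rho>" using \<rho> by (simp add: faithful_representation_def)
  then show "norm (\<rho> a) \<le> norm a" by (rule star_representation_contractive)
  have scaleR: "\<rho> (r *\<^sub>R a) = r *\<^sub>R \<rho> a" for r a
    using rep by (metis star_representation_def scaleC_of_real)
  show "norm a \<le> norm (\<rho> a)"
  proof (cases "a = 0")
    case False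
    define h where "h = star a * a"
    have nh: "norm h = norm a * norm a" by (simp add: h_def cstar_identity power2_eq_square)
    define r where "r = 1 / (2 * norm h)"
    have "r > 0" "norm (r *\<^sub>R h) \<le> 1 / 2" using False by (simp_all add: r_def nh)
    then have "norm (r *\<^sub>R h) \<le> norm (\<rho> (r *\<^sub>R h))"
      by (intro faithful_representation_lower_bound_self_adjoint \<rho>)
        (simp_all add: star_scaleR h_def star_mult star_star)
    then have "norm h \<le> norm (\<rho> h)" using \<open>r > 0\<close> by (simp add: scaleR)
    also have "\<rho> h = \<rho> (star a) * \<rho> a" using rep by (simp add: h_def star_representation_def)
    also have "norm \<dots> \<le> norm (\<rho> (star a)) * norm (\<rho> a)" by (rule norm_mult_ineq)
    also have "\<dots> \<le> norm a * norm (\<rho> a)"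
      using star_representation_contractive[OF rep, of "star a"]
      by (intro mult_right_mono) (simp_all add: norm_star)
    finally show ?thesis using False by (simp add: nh)
  qed simp
qed

section \<open>The compression of operators to the identity coordinate\<close>

text \<open>The elementary tensor of the point mass at \<open>g\<close> with \<open>v\<close>, when
  l^2(G, H) is read as l^2(G) tensor H.\<close>

lift_definition ell2_single :: "'g \<Rightarrow> 'h :: complex_normed_vector \<Rightarrow> ('g, 'h) ell2"
  is "\<lambda>g v h. if h = g then v else 0"
proof -
  fix g :: 'g and v :: 'h
  have "(\<lambda>h. (norm (if h = g then v else 0))\<^sup>2) summable_on {g}" by simp
  then show "(\<lambda>h. (norm (if h = g then v else 0))\<^sup>2) summable_on UNIV"
    by (rule summable_on_cong_neutral[THEN iffD1, rotated -1]) auto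
qed

lemma ell2_apply_single: "ell2_apply (ell2_single g v) h = (if h = g then v else 0)"
  by transfer simp

lemma ell2_norm_boundI:
  fixes \<xi> :: "('g, 'h :: complex_normed_vector) ell2"
  assumes "\<And>F. finite F \<Longrightarrow> L2_set (\<lambda>g. norm (ell2_apply \<xi> g)) F \<le> B"
  shows "norm \<xi> \<le> B"
  using assms by transfer (rule ell2_boundI(2))

lemma norm_ell2_single_le: "norm (ell2_single g v) \<le> norm v"
proof (rule ell2_norm_boundI)
  fix F :: "'a set" assume F: "finite F"
  have "(\<Sum>h\<in>F. (norm (ell2_apply (ell2_single g v) h))\<^sup>2) = (\<Sum>h\<in>F. if h = g then (norm v)\<^sup>2 else 0)"
    by (rule sum.cong) (auto simp: ell2_apply_single)
  also have "\<dots> \<le> (norm v)\<^sup>2" using F by simp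
  finally have "(\<Sum>h\<in>F. (norm (ell2_apply (ell2_single g v) h))\<^sup>2) \<le> (norm v)\<^sup>2" .
  then show "L2_set (\<lambda>h. norm (ell2_apply (ell2_single g v) h)) F \<le> norm v"
    by (simp add: L2_set_def real_le_lsqrt)
qed

lemma ell2_apply_sum: "ell2_apply (\<Sum>i\<in>S. \<xi> i) h = (\<Sum>i\<in>S. ell2_apply (\<xi> i) h)"
  by (induction S rule: infinite_finite_induct) simp_all

lemma apply_op_sum: "apply_op T (\<Sum>i\<in>S. \<xi> i) = (\<Sum>i\<in>S. apply_op T (\<xi> i))"
proof (induction S rule: infinite_finite_induct)
  case (infinite A)
  then show ?case using apply_op_scaleR[of T 0 0] by simp
next
  case empty
  then show ?case using apply_op_scaleR[of T 0 0] by simp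
qed (simp add: apply_op_add)

lemma apply_op_diff: "apply_op T (x - y) = apply_op T x - apply_op T y"
  using apply_op_add[of T "x - y" y] by simp

text \<open>The squared error is the tail of a convergent sum, which is small for a suitable finite
  set.\<close>

lemma ell2_finite_approximation:
  fixes \<xi> :: "('g, 'h :: complex_normed_vector) ell2"
  assumes "0 < e"
  shows "\<exists>F. finite F \<and> norm (\<xi> - (\<Sum>g\<in>F. ell2_single g (ell2_apply \<xi> g))) \<le> e"
proof -
  define f where "f g = (norm (ell2_apply \<xi> g))\<^sup>2" for g
  have s: "f summable_on UNIV"
    using Rep_ell2[of \<xi>] by (simp add: f_def[abs_def] ell2_apply.rep_eq)
  have "0 < e\<^sup>2" using assms by simp
  then obtain F where F: "finite F" "dist (sum f F) (infsum f UNIV) \<le> e\<^sup>2"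
    using infsum_finite_approximation[OF s] by blast
  have "norm (\<xi> - (\<Sum>g\<in>F. ell2_single g (ell2_apply \<xi> g))) \<le> e"
  proof (rule ell2_norm_boundI)
    fix F' :: "'g set" assume F': "finite F'"
    have eq: "ell2_apply (\<xi> - (\<Sum>g\<in>F. ell2_single g (ell2_apply \<xi> g))) h
        = (if h \<in> F then 0 else ell2_apply \<xi> h)" for h
      using F(1) by (simp add: ell2_apply_sum ell2_apply_single)
    have "(\<Sum>h\<in>F'. (norm (ell2_apply (\<xi> - (\<Sum>g\<in>F. ell2_single g (ell2_apply \<xi> g))) h))\<^sup>2)
        = sum f (F' - F)"
      unfolding eq f_def using F' by (intro sum.mono_neutral_cong_right) auto
    also have "\<dots> = sum f (F \<union> (F' - F)) - sum f F"
      using F(1) F' by (subst sum.union_disjoint) auto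
    also have "sum f (F \<union> (F' - F)) \<le> infsum f UNIV"
      using F(1) F' s by (intro finite_sum_le_infsum) (auto simp: f_def)
    finally have "(\<Sum>h\<in>F'. (norm (ell2_apply (\<xi> - (\<Sum>g\<in>F. ell2_single g (ell2_apply \<xi> g))) h))\<^sup>2) \<le> e\<^sup>2"
      using F(2) by (simp add: dist_real_def)
    then show "L2_set (\<lambda>h. norm (ell2_apply (\<xi> - (\<Sum>g\<in>F. ell2_single g (ell2_apply \<xi> g))) h)) F' \<le> e"
      using assms by (simp add: L2_set_def real_le_lsqrt)
  qed
  then show ?thesis using F(1) by blast
qed

lemma op_eq_zero_if_zero_on_singles:
  fixes T :: "('g, 'h :: complex_normed_vector) ell2 bounded_op"
  assumes "\<And>g v. apply_op T (ell2_single g v) = 0"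
  shows "T = 0"
proof (rule op_eqI)
  fix \<xi>
  have "norm (apply_op T \<xi>) \<le> e" if "0 < e" for e
  proof -
    \<comment> \<open>Adding 1 keeps the denominator positive even if \<open>T\<close> is
      zero.\<close>
    have "0 < e / (norm T + 1)" using that by (simp add: add_nonneg_pos)
    then obtain F where F: "finite F"
      "norm (\<xi> - (\<Sum>g\<in>F. ell2_single g (ell2_apply \<xi> g))) \<le> e / (norm T + 1)"
      using ell2_finite_approximation by blast
    have "apply_op T \<xi> = apply_op T (\<xi> - (\<Sum>g\<in>F. ell2_single g (ell2_apply \<xi> g)))"
      by (simp add: apply_op_diff apply_op_sum assms)
    also have "norm \<dots> \<le> norm T * (e / (norm T + 1))"
      by (rule order_trans[OF norm_apply_op mult_left_mono[OF F(2) norm_ge_zero]])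
    also have "\<dots> = e * (norm T / (norm T + 1))" by simp
    also have "\<dots> \<le> e"
      using that by (intro mult_right_le_one_le) (auto simp: divide_le_eq_1 add_nonneg_pos)
    finally show ?thesis .
  qed
  then have "norm (apply_op T \<xi>) \<le> 0" by (rule field_le_epsilon[of _ 0, simplified])
  then show "apply_op T \<xi> = apply_op 0 \<xi>" by (simp add: apply_zero_op)
qed

section \<open>Translations and the corner of an operator\<close>

lemma apply_translation_op_eq_shift: "apply_op (translation_op g) \<xi> = ell2_shift g \<xi>"
  by (rule ell2_eqI) (simp add: apply_translation_op ell2_apply_shift)

lemma norm_translation_op_le: "norm (translation_op g) \<le> 1"
  by (rule norm_op_bound) (simp_all add: apply_translation_op_eq_shift norm_ell2_shift)

lemma translation_op_single: "apply_op (translation_op g) (ell2_single h v) = ell2_single (g + h) v"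
proof (rule ell2_eqI)
  fix k
  have "- g + k = h \<longleftrightarrow> k = g + h" by (metis add_minus_cancel minus_add_cancel)
  then show "ell2_apply (apply_op (translation_op g) (ell2_single h v)) k = ell2_apply (ell2_single (g + h) v) k"
    by (simp add: apply_translation_op ell2_apply_single)
qed

lemma translation_op_zero: "translation_op 0 = 1"
  by (rule op_eqI, rule ell2_eqI) (simp add: apply_translation_op apply_one_op)

text \<open>On the crossed product this is \<open>\<rho>\<close> composed with the canonical
  conditional expectation E. Being defined for all bounded operators, it allows E to be handled
  without constructing it as a map into \<open>A\<close>.\<close>

definition corner :: "('g :: group_add, 'h :: complex_hilbert_space) ell2 bounded_op \<Rightarrow> 'h bounded_op"
  where "corner T = operator_of (\<lambda>v. ell2_apply (apply_op T (ell2_single 0 v)) 0)"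

lemma norm_apply_single_le: "norm (ell2_apply (apply_op T (ell2_single g v)) h) \<le> norm T * norm v"
  by (rule order_trans[OF norm_ell2_apply_le order_trans[OF norm_apply_op]])
    (simp add: mult_left_mono norm_ell2_single_le)

lemma apply_corner:
  fixes T :: "('g :: group_add, 'h :: complex_hilbert_space) ell2 bounded_op"
  shows "apply_op (corner T) v = ell2_apply (apply_op T (ell2_single 0 v)) 0"
  unfolding corner_def
proof (rule apply_operator_of[where B = "norm T"])
  fix x y :: 'h and z
  have "ell2_single (0 :: 'g) (x + y) = ell2_single 0 x + ell2_single 0 y"
    and "ell2_single (0 :: 'g) (z *\<^sub>C x) = z *\<^sub>C ell2_single 0 x"
    by (rule ell2_eqI, simp add: ell2_apply_single)+
  then show "ell2_apply (apply_op T (ell2_single 0 (x + y))) 0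
      = ell2_apply (apply_op T (ell2_single 0 x)) 0 + ell2_apply (apply_op T (ell2_single 0 y)) 0"
    and "ell2_apply (apply_op T (ell2_single 0 (z *\<^sub>C x))) 0
      = z *\<^sub>C ell2_apply (apply_op T (ell2_single 0 x)) 0"
    by (simp_all add: apply_op_add apply_op_scaleC)
qed (rule norm_apply_single_le)

lemma norm_corner_le: "norm (corner T) \<le> norm T"
  by (rule norm_op_bound) (simp_all add: apply_corner norm_apply_single_le)

lemma corner_zero: "corner 0 = 0"
  and corner_add: "corner (S + T) = corner S + corner T"
  and corner_diff: "corner (S - T) = corner S - corner T"
  and corner_scaleC: "corner (z *\<^sub>C T) = z *\<^sub>C corner T"
  by (rule op_eqI, simp add: apply_corner apply_zero_op apply_add_op apply_diff_op apply_scaleC_op)+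

lemma tendsto_corner: "X \<longlonglongrightarrow> T \<Longrightarrow> (\<lambda>n. corner (X n)) \<longlonglongrightarrow> corner T"
  by (rule Lim_transform_bound[where g = "\<lambda>n. X n - T", THEN LIM_zero_cancel])
    (auto simp: corner_diff[symmetric] norm_corner_le LIM_zero_iff)

text \<open>Every matrix entry of \<open>T\<close> is the corner of a two-sided translate of
  \<open>T\<close>, and a non-zero operator has a non-zero entry. As ideals absorb translations,
  this replaces faithfulness of E.\<close>

lemma ex_corner_nonzero:
  assumes "T \<noteq> 0"
  shows "\<exists>g h. corner (translation_op g * T * translation_op h) \<noteq> 0"
proof (rule ccontr)
  assume *: "\<not> ?thesis"
  have "apply_op T (ell2_single h v) = 0" for h v
  proof (rule ell2_eqI)
    fix g
    have "apply_op (corner (translation_op (- g) * T * translation_op h)) v = 0"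
      using * by (simp add: apply_zero_op)
    then show "ell2_apply (apply_op T (ell2_single h v)) g = ell2_apply 0 g"
      by (simp add: apply_corner apply_times_op translation_op_single apply_translation_op)
  qed
  then have "T = 0" by (rule op_eq_zero_if_zero_on_singles)
  then show False using assms by simp
qed

lemma closed_ideal_closure:
  fixes K :: "'a :: complex_normed_algebra set"
  assumes K: "csubspace K" and mult: "\<And>m x. x \<in> K \<Longrightarrow> m * x \<in> K \<and> x * m \<in> K"
  shows "closed_ideal UNIV (closure K)"
proof -
  have image: "f x \<in> closure K" if "continuous_on UNIV f" "\<And>x. x \<in> K \<Longrightarrow> f x \<in> closure K" "x \<in> closure K"
    for f :: "'a \<Rightarrow> 'a" and x
    using image_closure_subset[OF continuous_on_subset[OF that(1)], of K "closure K"] that(2,3) by auto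
  have sub: "0 \<in> K" "x + y \<in> K" "z *\<^sub>C x \<in> K" if "x \<in> K" "y \<in> K" for x y z
    using K that by (auto simp: complex_vector.subspace_def)
  \<comment> \<open>Sums are treated one variable at a time: first with one summand in the closure,
    then with both.\<close>
  have "x + y \<in> closure K" if "x \<in> closure K" "y \<in> K" for x y
    by (rule image[of "\<lambda>x. x + y" x, OF _ _ that(1)])
      (use that(2) sub in \<open>auto intro!: continuous_intros subsetD[OF closure_subset]\<close>)
  then have "x + y \<in> closure K" if "x \<in> closure K" "y \<in> closure K" for x y
    using image[of "\<lambda>y. x + y" y] that by (simp add: continuous_on_add continuous_on_const continuous_on_id)
  moreover have "continuous_on UNIV (\<lambda>x :: 'a. z *\<^sub>C x)" for z
  proof (rule linear_continuous_on, rule bounded_linear_intro[where K = "cmod z"])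
    fix x y :: 'a and r :: real
    show "z *\<^sub>C (r *\<^sub>R x) = r *\<^sub>R z *\<^sub>C x"
      by (simp only: scaleC_of_real[symmetric] scaleC_scaleC mult.commute)
  qed (simp_all add: scaleC_add_right norm_scaleC)
  then have "z *\<^sub>C x \<in> closure K" if "x \<in> closure K" for z x
    using image that sub closure_subset[of K] by blast
  moreover have "m * x \<in> closure K" "x * m \<in> closure K" if "x \<in> closure K" for m x
    by (rule image[OF _ _ that], use mult closure_subset[of K] in \<open>auto intro!: continuous_intros\<close>)+
  moreover have "0 \<in> closure K"
    using K closure_subset[of K] by (auto simp: complex_vector.subspace_def)
  ultimately show ?thesis
    by (simp add: closed_ideal_def complex_vector.subspace_def)
qed

section \<open>Ideals of the reduced crossed product\<close>

locale crossed_product =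
  fixes \<alpha> :: "'g :: group_add \<Rightarrow> 'a :: unital_cstar_algebra \<Rightarrow> 'a"
    and \<rho> :: "'a \<Rightarrow> 'h :: complex_hilbert_space bounded_op"
  assumes action: "cstar_action \<alpha>"
    and faithful: "faithful_representation \<rho>"
begin

abbreviation "\<pi> \<equiv> regular_rep \<rho> \<alpha>"
abbreviation "u \<equiv> translation_op :: 'g \<Rightarrow> ('g, 'h) ell2 bounded_op"
abbreviation "M \<equiv> reduced_crossed_product \<rho> \<alpha>"
abbreviation "D \<equiv> cspan {\<pi> a * u g | a g. True}"

lemma rep: "star_representation \<rho>"
  using faithful by (simp add: faithful_representation_def)

lemma rho: "\<rho> (a + b) = \<rho> a + \<rho> b" "\<rho> (z *\<^sub>C a) = z *\<^sub>C \<rho> a" "\<rho> (a * b) = \<rho> a * \<rho> b" "\<rho> 1 = 1"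
  using rep by (simp_all add: star_representation_def)

lemma rho_diff: "\<rho> (a - b) = \<rho> a - \<rho> b"
  using rho(1)[of "a - b" b] by simp

lemma rho_zero: "\<rho> 0 = 0"
  using rho(1)[of 0 0] by simp

lemma rho_eq_iff: "\<rho> a = \<rho> b \<longleftrightarrow> a = b"
  using faithful by (simp add: faithful_representation_def inj_eq)

lemma norm_rho: "norm (\<rho> a) = norm a"
  using faithful by (rule faithful_representation_isometric)

lemma alpha: "\<alpha> g (a + b) = \<alpha> g a + \<alpha> g b" "\<alpha> g (z *\<^sub>C a) = z *\<^sub>C \<alpha> g a" "\<alpha> g (a * b) = \<alpha> g a * \<alpha> g b"
    "\<alpha> g (star a) = star (\<alpha> g a)" "bij (\<alpha> g)" "\<alpha> 0 a = a" "\<alpha> (g + h) a = \<alpha> g (\<alpha> h a)"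
  using action by (simp_all add: cstar_action_def star_automorphism_def)

lemma alpha_one: "\<alpha> g 1 = 1"
proof -
  obtain v where "\<alpha> g v = 1" using alpha(5) by (metis bij_pointE)
  then show ?thesis using alpha(3)[of g 1 v] alpha(3)[of g v 1] by simp
qed

lemma alpha_zero: "\<alpha> g 0 = 0"
  using alpha(1)[of g 0 0] by simp

lemma alpha_diff: "\<alpha> g (a - b) = \<alpha> g a - \<alpha> g b"
  using alpha(1)[of g "a - b" b] by simp

text \<open>\<open>\<rho>\<close> composed with \<open>\<alpha> g\<close> is again a representation,
  hence contractive, and \<open>\<rho>\<close> itself preserves norms.\<close>

lemma norm_alpha_le: "norm (\<alpha> g a) \<le> norm a"
proof -
  have "star_representation (\<lambda>a. \<rho> (\<alpha> g a))"
    using rep by (simp add: star_representation_def alpha alpha_one)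
  then show ?thesis
    using star_representation_contractive by (metis norm_rho)
qed

lemma apply_pi: "ell2_apply (apply_op (\<pi> a) \<xi>) h = apply_op (\<rho> (\<alpha> (- h) a)) (ell2_apply \<xi> h)"
  using rep action by (rule apply_regular_rep)

lemma pi_one: "\<pi> 1 = 1"
  by (rule op_eqI, rule ell2_eqI) (simp add: apply_pi alpha_one rho apply_one_op)

lemma generator_mem: "\<pi> a * u g \<in> D"
  by (rule complex_vector.span_base) blast

lemma D_subset_M: "D \<subseteq> M"
  by (simp add: reduced_crossed_product_def closure_subset)

lemma pi_mem: "\<pi> a \<in> M"
  using generator_mem[of a 0] D_subset_M by (auto simp: translation_op_zero)

text \<open>Since \<open>A\<close> is unital, the translations themselves lie in \<open>M\<close>,
  so ideals of \<open>M\<close> are stable under conjugation by them.\<close>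

lemma u_mem: "u g \<in> M"
  using generator_mem[of 1 g] D_subset_M by (auto simp: pi_one)

lemma D_induct [consumes 1, case_names zero add scale generator]:
  assumes "x \<in> D" "P 0" "\<And>x y. P x \<Longrightarrow> P y \<Longrightarrow> P (x + y)" "\<And>z x. P x \<Longrightarrow> P (z *\<^sub>C x)"
    "\<And>a g. P (\<pi> a * u g)"
  shows "P x"
proof (rule complex_vector.span_induct[OF assms(1), where P = P])
  show "csubspace {x. P x}" using assms by (simp add: complex_vector.subspace_def)
qed (use assms(5) in auto)

section \<open>The conditional expectation and its equivariance\<close>

lemma apply_generator:
  "ell2_apply (apply_op (\<pi> a * u g) \<xi>) h = apply_op (\<rho> (\<alpha> (- h) a)) (ell2_apply \<xi> (- g + h))"
  by (simp add: apply_times_op apply_pi apply_translation_op)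

text \<open>The witness is E(x), the coefficient at the identity. One \<open>a\<close> serving all
  \<open>k\<close> encodes equivariance of E; \<open>k = 0\<close> recovers E(x) itself.\<close>

lemma corner_conj_D:
  assumes "x \<in> D"
  shows "\<exists>a. \<forall>k. corner (u k * x * u (- k)) = \<rho> (\<alpha> k a)"
  using assms
proof (induction rule: D_induct)
  case zero
  then show ?case by (intro exI[of _ 0]) (simp add: corner_zero alpha_zero rho_zero)
next
  case (add x y)
  then obtain a b where "\<And>k. corner (u k * x * u (- k)) = \<rho> (\<alpha> k a)"
    "\<And>k. corner (u k * y * u (- k)) = \<rho> (\<alpha> k b)" by blast
  then show ?case
    by (intro exI[of _ "a + b"]) (simp add: distrib_left distrib_right corner_add alpha rho)
next
  case (scale z x)
  then obtain a where "\<And>k. corner (u k * x * u (- k)) = \<rho> (\<alpha> k a)" by blast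
  then show ?case
    by (intro exI[of _ "z *\<^sub>C a"]) (simp add: mult_scaleC_left mult_scaleC_right corner_scaleC alpha rho)
next
  case (generator a g)
  have "corner (u k * (\<pi> a * u g) * u (- k)) = \<rho> (\<alpha> k (if g = 0 then a else 0))" for k
  proof (rule op_eqI)
    fix v
    \<comment> \<open>\<open>u (- k)\<close> moves the vector to position \<open>- k\<close>, while
      the generator reads position \<open>- g - k\<close>; these agree only for the
      identity.\<close>
    have "- g - k = - k \<longleftrightarrow> g = 0" by (metis add_0 add_right_cancel diff_conv_add_uminus neg_0_equal_iff_equal)
    then show "apply_op (corner (u k * (\<pi> a * u g) * u (- k))) v = apply_op (\<rho> (\<alpha> k (if g = 0 then a else 0))) v"
      using apply_op_scaleR[of "\<rho> (\<alpha> k a)" 0 v]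
      by (simp add: apply_corner apply_times_op[of _ "u (- k)"] apply_times_op[of "u k"]
          translation_op_single apply_translation_op apply_generator ell2_apply_single
          alpha_zero rho_zero apply_zero_op)
  qed
  then show ?case by blast
qed

text \<open>Since \<open>\<rho>\<close> is isometric, the coefficients of an approximating sequence
  are Cauchy and converge in \<open>A\<close>; continuity of \<open>\<alpha> k\<close> lets the one
  limit serve every \<open>k\<close>.\<close>

lemma corner_conj_M:
  assumes "x \<in> M"
  shows "\<exists>a. \<forall>k. corner (u k * x * u (- k)) = \<rho> (\<alpha> k a)"
proof -
  obtain X where X: "\<And>n. X n \<in> D" "X \<longlonglongrightarrow> x"
    using assms unfolding reduced_crossed_product_def closure_sequential by blast
  obtain a where a: "\<And>n k. corner (u k * X n * u (- k)) = \<rho> (\<alpha> k (a n))"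
    using corner_conj_D[OF X(1)] by metis
  have "norm (a m - a n) \<le> norm (X m - X n)" for m n
  proof -
    have "\<rho> (a m - a n) = corner (X m - X n)"
      using a[of 0 m] a[of 0 n] by (simp add: translation_op_zero alpha corner_diff rho_diff)
    then show ?thesis using norm_corner_le[of "X m - X n"] by (simp add: norm_rho[symmetric])
  qed
  then have "Cauchy a"
    using LIMSEQ_imp_Cauchy[OF X(2)] unfolding Cauchy_iff by (meson le_less_trans)
  then obtain b where b: "a \<longlonglongrightarrow> b" using Cauchy_convergent unfolding convergent_def by blast
  have "corner (u k * x * u (- k)) = \<rho> (\<alpha> k b)" for k
  proof (rule LIMSEQ_unique)
    show "(\<lambda>n. corner (u k * X n * u (- k))) \<longlonglongrightarrow> corner (u k * x * u (- k))"
      by (intro tendsto_corner tendsto_intros X(2))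
    have "(\<lambda>n. \<rho> (\<alpha> k (a n)) - \<rho> (\<alpha> k b)) \<longlonglongrightarrow> 0"
      by (rule Lim_transform_bound[where g = "\<lambda>n. a n - b"])
        (use b in \<open>auto simp: rho_diff[symmetric] alpha_diff[symmetric] norm_rho norm_alpha_le LIM_zero_iff\<close>)
    then show "(\<lambda>n. corner (u k * X n * u (- k))) \<longlonglongrightarrow> \<rho> (\<alpha> k b)"
      unfolding a by (rule LIM_zero_cancel)
  qed
  then show ?thesis by blast
qed

text \<open>The bimodule property of E, from the fact that \<open>\<pi> b\<close> is diagonal with
  entry \<open>\<rho> b\<close> at the identity.\<close>

lemma corner_mult_pi: "corner (\<pi> b * x) = \<rho> b * corner x" "corner (x * \<pi> b) = corner x * \<rho> b"
proof -
  have "apply_op (\<pi> b) (ell2_single 0 v) = ell2_single 0 (apply_op (\<rho> b) v)" for v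
    using apply_op_scaleR[of _ 0 v] by (intro ell2_eqI) (simp add: apply_pi ell2_apply_single alpha)
  then show "corner (\<pi> b * x) = \<rho> b * corner x" "corner (x * \<pi> b) = corner x * \<rho> b"
    by (auto intro!: op_eqI simp: apply_corner apply_times_op apply_pi alpha)
qed

text \<open>The set \<open>K\<close> is E(I): an ideal by the bimodule property, invariant by
  equivariance, non-zero because some translate of a non-zero element has a non-zero corner. By
  minimality its closure contains 1.\<close>

lemma ex_corner_near_one:
  assumes minimal: "minimal_action \<alpha>" and I: "closed_ideal M I" "I \<noteq> {0}" and "0 < e"
  shows "\<exists>x\<in>I. \<exists>a. corner x = \<rho> a \<and> norm (1 - a) < e"
proof -
  define K where "K = {a. \<exists>x\<in>I. corner x = \<rho> a}"
  have mult: "m * x \<in> I" "x * m \<in> I" if "m \<in> M" "x \<in> I" for m x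
    using I that by (auto simp: closed_ideal_def)
  have sub: "0 \<in> I" "x + y \<in> I" "z *\<^sub>C x \<in> I" if "x \<in> I" "y \<in> I" for x y z
    using I that by (auto simp: closed_ideal_def complex_vector.subspace_def)
  have "0 \<in> I" using I by (auto simp: closed_ideal_def complex_vector.subspace_def)
  have IM: "x \<in> M" if "x \<in> I" for x
    using I that by (auto simp: closed_ideal_def)
  have KI: "a \<in> K" if "x \<in> I" "corner x = \<rho> a" for x a
    using that by (auto simp: K_def)
  have "csubspace K"
    unfolding complex_vector.subspace_def
  proof (intro conjI allI ballI)
    show "0 \<in> K" using KI[OF \<open>0 \<in> I\<close>, of 0] by (simp add: corner_zero rho_zero)
    show "a + b \<in> K" if ab: "a \<in> K" "b \<in> K" for a b
    proof -
      obtain x y where "x \<in> I" "corner x = \<rho> a" "y \<in> I" "corner y = \<rho> b"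
        using ab by (auto simp: K_def)
      then show ?thesis by (intro KI[of "x + y"] sub) (simp_all add: corner_add rho)
    qed
    show "z *\<^sub>C a \<in> K" if a: "a \<in> K" for a z
    proof -
      obtain x where "x \<in> I" "corner x = \<rho> a" using a by (auto simp: K_def)
      then show ?thesis by (intro KI[of "z *\<^sub>C x"] sub) (simp_all add: corner_scaleC rho)
    qed
  qed
  moreover have "b * a \<in> K \<and> a * b \<in> K" if a: "a \<in> K" for a b
  proof -
    obtain x where "x \<in> I" "corner x = \<rho> a" using a by (auto simp: K_def)
    then show ?thesis
      by (intro conjI KI[of "\<pi> b * x"] KI[of "x * \<pi> b"] mult pi_mem) (simp_all add: corner_mult_pi rho)
  qed
  ultimately have "closed_ideal UNIV (closure K)"
    by (rule closed_ideal_closure)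
  moreover have "\<alpha> g ` closure K \<subseteq> closure K" for g
  proof (rule image_closure_subset)
    have "bounded_linear (\<alpha> g)"
    proof (rule bounded_linear_intro[where K = 1])
      show "\<alpha> g (r *\<^sub>R x) = r *\<^sub>R \<alpha> g x" for r x by (simp only: scaleC_of_real[symmetric] alpha)
    qed (simp_all add: alpha norm_alpha_le)
    then show "continuous_on (closure K) (\<alpha> g)" by (rule linear_continuous_on)
    show "\<alpha> g ` K \<subseteq> closure K"
    proof
      fix c assume "c \<in> \<alpha> g ` K"
      then obtain x a where x: "x \<in> I" "corner x = \<rho> a" "c = \<alpha> g a" by (auto simp: K_def)
      obtain b where b: "\<And>k. corner (u k * x * u (- k)) = \<rho> (\<alpha> k b)"
        using corner_conj_M[OF IM[OF x(1)]] by blast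
      have "b = a" using b[of 0] x(2) by (simp add: translation_op_zero alpha rho_eq_iff)
      then have "c \<in> K"
        using b[of g] x by (intro KI[of "u g * x * u (- g)"] mult u_mem) simp_all
      then show "c \<in> closure K" using closure_subset by blast
    qed
  qed simp
  moreover have "closure K \<noteq> {0}"
  proof -
    obtain x where x: "x \<in> I" "x \<noteq> 0" using I \<open>0 \<in> I\<close> by blast
    then obtain g h where gh: "corner (u g * x * u h) \<noteq> 0" using ex_corner_nonzero by blast
    have "u g * x * u h \<in> I" using mult u_mem x by blast
    moreover from this obtain a where "corner (u g * x * u h) = \<rho> a"
      using corner_conj_M[OF IM, of "u g * x * u h"] by (metis add_0 alpha(6) minus_zero mult_1_left mult_1_right translation_op_zero)
    ultimately have "a \<in> K" "a \<noteq> 0" using gh by (auto simp: K_def rho_zero)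
    then show ?thesis using closure_subset[of K] by blast
  qed
  ultimately have "closure K = UNIV" using minimal unfolding minimal_action_def by blast
  then have "1 \<in> closure K" by simp
  then obtain a where "a \<in> K" "dist a 1 < e" using \<open>0 < e\<close> unfolding closure_approachable by blast
  then show ?thesis by (auto simp: K_def dist_norm norm_minus_commute[of a])
qed

section \<open>Supports of finite sums, and primeness\<close>

text \<open>Coordinate 0 of \<open>\<pi> a * u g\<close> applied to \<open>\<xi>\<close> depends
  only on \<open>\<xi>\<close> at \<open>- g\<close>. So \<open>F\<close> can collect the inverses
  of the non-zero group elements in a finite sum for \<open>x\<close>; if \<open>\<xi>\<close>
  vanishes there, only the coefficient at the identity contributes.\<close>

lemma corner_mult_D:
  assumes "x \<in> D"
  shows "\<exists>F. finite F \<and> 0 \<notin> F \<and> (\<forall>\<xi>. (\<forall>s\<in>F. ell2_apply \<xi> s = 0) \<longrightarrow>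
    ell2_apply (apply_op x \<xi>) 0 = apply_op (corner x) (ell2_apply \<xi> 0))"
  using assms
proof (induction rule: D_induct)
  case zero
  then show ?case by (auto simp: apply_zero_op corner_zero)
next
  case (add x y)
  then obtain F F' where
    "finite F" "0 \<notin> F" "\<And>\<xi>. \<forall>s\<in>F. ell2_apply \<xi> s = 0 \<Longrightarrow> ell2_apply (apply_op x \<xi>) 0 = apply_op (corner x) (ell2_apply \<xi> 0)"
    "finite F'" "0 \<notin> F'" "\<And>\<xi>. \<forall>s\<in>F'. ell2_apply \<xi> s = 0 \<Longrightarrow> ell2_apply (apply_op y \<xi>) 0 = apply_op (corner y) (ell2_apply \<xi> 0)"
    by blast
  then show ?case by (intro exI[of _ "F \<union> F'"]) (simp add: apply_add_op corner_add)
next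
  case (scale z x)
  then show ?case by (auto simp: apply_scaleC_op corner_scaleC)
next
  case (generator a g)
  show ?case
  proof (cases "g = 0")
    case True
    then show ?thesis
      by (intro exI[of _ "{}"]) (simp add: apply_corner apply_generator ell2_apply_single)
  next
    case False
    then show ?thesis
      using apply_op_scaleR[of _ 0 "0 :: 'h"]
      by (intro exI[of _ "{- g}"]) (simp add: apply_corner apply_generator ell2_apply_single)
  qed
qed

text \<open>A bound for the support of \<open>y\<close> away from the identity, read off from the
  vectors at position 0. All conjugates are covered at once because \<open>E\<close> must be fixed
  before \<open>g\<close> is chosen; exempting \<open>t = 0\<close> lets \<open>E\<close> avoid 0,
  as \<open>ex_conjugate_disjoint\<close> requires.\<close>

definition conj_supported :: "('g, 'h) ell2 bounded_op \<Rightarrow> 'g set \<Rightarrow> bool"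
  where "conj_supported y E \<longleftrightarrow> (\<forall>g v t. t \<noteq> 0 \<longrightarrow> t \<notin> (\<lambda>r. g + r - g) ` E \<longrightarrow>
    ell2_apply (apply_op (u g * y * u (- g)) (ell2_single 0 v)) t = 0)"

lemma ex_conj_supported:
  assumes "y \<in> D"
  shows "\<exists>E. finite E \<and> 0 \<notin> E \<and> conj_supported y E"
  using assms
proof (induction rule: D_induct)
  case zero
  then show ?case by (intro exI[of _ "{}"]) (simp add: conj_supported_def apply_zero_op)
next
  case (add x y)
  then obtain E E' where "finite E" "0 \<notin> E" "conj_supported x E" "finite E'" "0 \<notin> E'" "conj_supported y E'"
    by blast
  moreover from this have "conj_supported (x + y) (E \<union> E')"
    by (simp add: conj_supported_def distrib_left distrib_right apply_add_op image_Un)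
  ultimately show ?case by (intro exI[of _ "E \<union> E'"]) simp
next
  case (scale z x)
  moreover have "conj_supported (z *\<^sub>C x) E" if "conj_supported x E" for E
    using that by (simp add: conj_supported_def mult_scaleC_left mult_scaleC_right apply_scaleC_op)
  ultimately show ?case by blast
next
  case (generator b r)
  have supp: "ell2_apply (apply_op (u g * (\<pi> b * u r) * u (- g)) (ell2_single 0 v)) t = 0"
    if "t \<noteq> g + r - g" for g v t
  proof -
    \<comment> \<open>The conjugated generator sends position 0 to \<open>g + r - g\<close>, so
      every other coordinate reads a zero entry.\<close>
    have "- r + (- g + t) \<noteq> - g"
    proof
      assume "- r + (- g + t) = - g"
      then have "t = g + r - g"
        by (metis add.assoc add_minus_cancel diff_conv_add_uminus)
      then show False using that by simp
    qed
    then show ?thesis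
      using apply_op_scaleR[of _ 0 "0 :: 'h"]
      by (simp add: apply_times_op[of _ "u (- g)"] apply_times_op[of "u g"]
          translation_op_single apply_translation_op apply_generator ell2_apply_single)
  qed
  show ?case
    by (rule exI[of _ "{r} - {0}"])
      (use supp in \<open>cases "r = 0"; simp add: conj_supported_def\<close>)
qed

text \<open>The estimates end in \<open>norm 1 < 1\<close>. This is possible only in the zero
  algebra, where all operators on the l^2 space vanish and \<open>I\<close> could not be
  non-zero.\<close>

lemma prime_if_icc_minimal:
  assumes icc: "icc_group TYPE('g)" and minimal: "minimal_action \<alpha>"
  shows "prime_cstar_algebra M"
  unfolding prime_cstar_algebra_def
proof (intro allI impI notI, elim conjE)
  fix I J
  assume I: "closed_ideal M I" "I \<noteq> {0}" and J: "closed_ideal M J" "J \<noteq> {0}"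
    and zero: "ideal_product I J = {0}"
  obtain x a where x: "x \<in> I" "corner x = \<rho> a" "norm (1 - a) < 1 / 4"
    using ex_corner_near_one[OF minimal I, of "1 / 4"] by auto
  obtain y b where y: "y \<in> J" "corner y = \<rho> b" "norm (1 - b) < 1 / 4"
    using ex_corner_near_one[OF minimal J, of "1 / 4"] by auto
  have IJM: "x \<in> M" "y \<in> M" using x y I J by (auto simp: closed_ideal_def)
  have prod: "p * q = 0" if "p \<in> I" "q \<in> J" for p q
  proof -
    have "p * q \<in> ideal_product I J"
      unfolding ideal_product_def
      by (rule subsetD[OF closure_subset], rule complex_vector.span_base) (use that in blast)
    then show ?thesis by (simp add: zero)
  qed
  \<comment> \<open>The first bound is used as 1/4 + 1/12 = 1/3 for \<open>P\<close> and
    \<open>Q\<close>, the second to keep \<open>P * Q\<close> within 1/9.\<close>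
  define e where "e = min (1 / 12) (1 / (9 * (norm x + norm y + 1)))"
  have "0 < e" by (simp add: e_def add_nonneg_pos)
  have e: "e \<le> 1 / 12" "e * (norm x + norm y + 1) \<le> 1 / 9"
  proof -
    have "e * (norm x + norm y + 1) \<le> 1 / (9 * (norm x + norm y + 1)) * (norm x + norm y + 1)"
      by (intro mult_right_mono) (auto simp: e_def)
    also have "\<dots> = 1 / 9"
    proof -
      have "norm x + norm y + 1 \<noteq> 0" by (smt (verit) norm_ge_zero)
      then show ?thesis by (simp add: field_simps)
    qed
    finally show "e * (norm x + norm y + 1) \<le> 1 / 9" .
  qed (simp add: e_def)
  obtain x' where x': "x' \<in> D" "norm (x' - x) < e"
    using IJM(1) \<open>0 < e\<close> unfolding reduced_crossed_product_def closure_approachable dist_norm by blast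
  obtain y' where y': "y' \<in> D" "norm (y' - y) < e"
    using IJM(2) \<open>0 < e\<close> unfolding reduced_crossed_product_def closure_approachable dist_norm by blast
  obtain F where F: "finite F" "0 \<notin> F" "\<And>\<xi>. \<forall>s\<in>F. ell2_apply \<xi> s = 0 \<Longrightarrow>
      ell2_apply (apply_op x' \<xi>) 0 = apply_op (corner x') (ell2_apply \<xi> 0)"
    using corner_mult_D[OF x'(1)] by blast
  obtain E where E: "finite E" "0 \<notin> E" "conj_supported y' E"
    using ex_conj_supported[OF y'(1)] by blast
  obtain g where g: "\<And>r. r \<in> E \<Longrightarrow> g + r - g \<notin> F"
    using ex_conjugate_disjoint[OF icc E(1) F(1) E(2)] by blast
  define c where "c t = u g * t * u (- g)" for t
  have c: "norm (c t) \<le> norm t" for t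
  proof -
    have "norm (c t) \<le> norm (u g) * norm t * norm (u (- g))"
      unfolding c_def by (rule order_trans[OF norm_mult_ineq mult_right_mono[OF norm_mult_ineq norm_ge_zero]])
    also have "\<dots> \<le> 1 * norm t * 1"
      by (intro mult_mono norm_translation_op_le) auto
    finally show ?thesis by simp
  qed
  have c_diff: "c (s - t) = c s - c t" for s t
    by (simp add: c_def algebra_simps)
  define P where "P = corner x'"
  define Q where "Q = corner (c y')"
  have PQ: "corner (x' * c y') = P * Q"
  proof (rule op_eqI)
    fix v
    \<comment> \<open>Elements of \<open>F\<close> are non-zero and lie outside the conjugate of
      \<open>E\<close> by \<open>g\<close>, so the vector vanishes on \<open>F\<close> and
      \<open>x'\<close> acts at coordinate 0 through its corner alone.\<close>
    have "ell2_apply (apply_op (c y') (ell2_single 0 v)) s = 0" if "s \<in> F" for s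
      unfolding c_def using that F(2) g by (intro E(3)[unfolded conj_supported_def, rule_format]) auto
    then show "apply_op (corner (x' * c y')) v = apply_op (P * Q) v"
      by (simp add: P_def Q_def apply_times_op apply_corner[of "_ * _"] F(3))
        (simp add: apply_corner)
  qed
  have "c y \<in> J" using J(1) y(1) u_mem by (simp add: c_def closed_ideal_def)
  then have "x * c y = 0" using prod x(1) by blast
  \<comment> \<open>The product of the exact elements is zero, so only the approximation errors
    remain.\<close>
  then have "x' * c y' = (x' - x) * c y' + x * c (y' - y)" by (simp add: c_diff algebra_simps)
  then have "norm (x' * c y') \<le> norm (x' - x) * norm (c y') + norm x * norm (c (y' - y))"
    by (metis norm_triangle_mono norm_mult_ineq)
  also have "\<dots> \<le> e * (norm y + 1) + norm x * e"
  proof (intro add_mono mult_mono)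
    have "norm (c y') \<le> norm y'" by (rule c)
    also have "\<dots> \<le> norm y + norm (y' - y)" by (rule norm_triangle_sub)
    finally show "norm (c y') \<le> norm y + 1" using y'(2) e by simp
    show "norm (c (y' - y)) \<le> e" using c[of "y' - y"] y'(2) by simp
  qed (use x' \<open>0 < e\<close> in auto)
  also have "\<dots> = e * (norm x + norm y + 1)" by (simp add: algebra_simps)
  finally have nPQ: "norm (P * Q) \<le> 1 / 9"
    using e(2) norm_corner_le[of "x' * c y'"] by (simp add: PQ)
  have P: "norm (1 - P) \<le> 1 / 3"
  proof -
    have "1 - P = \<rho> (1 - a) - corner (x' - x)"
      by (simp add: P_def corner_diff x(2) rho_diff rho)
    then have "norm (1 - P) \<le> norm (1 - a) + norm (x' - x)"
      using norm_triangle_ineq4[of "\<rho> (1 - a)" "corner (x' - x)"] norm_corner_le[of "x' - x"]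
      by (simp add: norm_rho)
    then show ?thesis using x(3) x'(2) e(1) by linarith
  qed
  have Q: "norm (1 - Q) \<le> 1 / 3"
  proof -
    \<comment> \<open>By equivariance the corner of \<open>c y\<close> is
      \<open>\<rho> (\<alpha> g b)\<close>, and \<open>\<alpha> g\<close> fixes 1, so conjugation
      does not spoil closeness to 1.\<close>
    obtain b' where b': "\<And>k. corner (u k * y * u (- k)) = \<rho> (\<alpha> k b')"
      using corner_conj_M[OF IJM(2)] by blast
    have "b' = b" using b'[of 0] y(2) by (simp add: translation_op_zero alpha rho_eq_iff)
    then have "1 - Q = \<rho> (\<alpha> g (1 - b)) - corner (c (y' - y))"
      using b'[of g] by (simp add: Q_def c_diff corner_diff c_def[of y] alpha_diff alpha_one rho_diff rho)
    then have "norm (1 - Q) \<le> norm (1 - b) + norm (y' - y)"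
      using norm_triangle_ineq4[of "\<rho> (\<alpha> g (1 - b))" "corner (c (y' - y))"]
        norm_corner_le[of "c (y' - y)"] c[of "y' - y"] norm_alpha_le[of g "1 - b"]
      by (simp add: norm_rho)
    then show ?thesis using y(3) y'(2) e(1) by linarith
  qed
  \<comment> \<open>The four terms have norms at most 1/9, 1/3, 1/3 and 1/9, which add up to
    8/9.\<close>
  have "1 = P * Q + (1 - P) + (1 - Q) - (1 - P) * (1 - Q)" by (simp add: algebra_simps)
  then have "norm (1 :: 'h bounded_op) = norm (P * Q + (1 - P) + (1 - Q) - (1 - P) * (1 - Q))"
    by (rule arg_cong)
  also have "\<dots> \<le> norm (P * Q) + norm (1 - P) + norm (1 - Q) + norm ((1 - P) * (1 - Q))"
    using norm_triangle_ineq4[of "P * Q + (1 - P) + (1 - Q)" "(1 - P) * (1 - Q)"]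
      norm_triangle_ineq[of "P * Q + (1 - P)" "1 - Q"] norm_triangle_ineq[of "P * Q" "1 - P"] by linarith
  also have "norm ((1 - P) * (1 - Q)) \<le> 1 / 3 * (1 / 3)"
    by (rule order_trans[OF norm_mult_ineq mult_mono[OF P Q]]) simp_all
  finally have "norm (1 :: 'h bounded_op) < 1" using nPQ P Q by simp
  then have "norm (1 :: 'a) < 1" using norm_rho[of 1] by (simp add: rho)
  moreover have "norm (1 :: 'a) = 0 \<or> norm (1 :: 'a) = 1"
    using cstar_identity[of "1 :: 'a"] by (simp add: star_one power2_eq_square)
  ultimately have one: "(1 :: 'a) = 0" by auto
  have "T = 0" for T :: "('g, 'h) ell2 bounded_op"
  proof -
    have "\<pi> 1 = \<pi> 0" by (simp add: one)
    moreover have "\<pi> 0 = 0"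
      by (rule op_eqI, rule ell2_eqI) (simp add: apply_pi alpha_zero rho_zero apply_zero_op)
    ultimately have "1 = (0 :: ('g, 'h) ell2 bounded_op)" by (simp add: pi_one)
    then show ?thesis by (metis mult_1_left mult_zero_left)
  qed
  then have "I = {0}" using x(1) by (metis insertI1 singleton_iff subsetI subset_antisym)
  then show False using I(2) by simp
qed

end

theorem corollaryD:
  fixes \<alpha> :: "'g :: group_add \<Rightarrow> 'a :: unital_cstar_algebra \<Rightarrow> 'a"
    and \<rho> :: "'a \<Rightarrow> 'h :: complex_hilbert_space bounded_op"
  assumes "icc_group TYPE('g)"
    and "cstar_action \<alpha>"
    and "minimal_action \<alpha>"
    and "faithful_representation \<rho>"
  shows "prime_cstar_algebra (reduced_crossed_product \<rho> \<alpha>)"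
proof -
  interpret crossed_product \<alpha> \<rho>
    using assms by unfold_locales
  show ?thesis
    using assms by (intro prime_if_icc_minimal)
qed

end
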